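(* Let $(i,j)\in\{-1,1\}^2$. The full subcategory $\mathscr{Y}(\mathbb{H})_{i,j}$ of $\mathscr{Y}(\mathbb{H})$ is equivalent to the groupoid $\mathscr{Z}$ of the action of $\mathbb{H}^\ast/\mathbb{R}^\ast$ on $(\mathbb{H}^\ast/\mathbb{R}^\ast)^2\times\mathrm{SPds}(\mathbb{H})^2$ given by $$s\cdot((a,b),(\delta,\epsilon))=\left((sas^{-1},sbs^{-1}),(c_s\delta c_s^{-1},c_s\epsilon c_s^{-1})\right).$$ An equivalence $\mathscr{H}_{i,j}:\mathscr{Z}\to\mathscr{Y}(\mathbb{H})_{i,j}$ is given by $\mathscr{H}_{i,j}(s)=c_s$ for morphisms $s\in\mathbb{H}^\ast/\mathbb{R}^\ast$, and on objects by \begin{align*} \mathscr{H}_{1,1}((a,b),(\delta,\epsilon))&=([\mathrm{L}_a,\mathrm{R}_b],(\delta,\epsilon),(\mathbb{I},\mathbb{I})),\\ \mathscr{H}_{-1,1}((a,b),(\delta,\epsilon))&=([\mathrm{R}_a,\mathrm{R}_b],(\delta,\epsilon),(\kappa,\mathbb{I})),\\ \mathscr{H}_{1,-1}((a,b),(\delta,\epsilon))&=([\mathrm{L}_a,\mathrm{L}_b],(\delta,\epsilon),(\mathbb{I},\kappa)),\\ \mathscr{H}_{-1,-1}((a,b),(\delta,\epsilon))&=([\mathrm{L}_a,\mathrm{R}_b],(\delta,\epsilon),(\kappa,\kappa)). \end{align*}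
   Context: $\mathbb{H}$ is Hamilton's quaternion algebra over $\mathbb{R}$, with its Euclidean norm form $n(x)=x\bar x$, where $\kappa:x\mapsto\bar x$ is the standard conjugation; $\mathbb{I}$ is the identity map and $\mathrm{C}_2=\{\mathbb{I},\kappa\}$. $\mathrm{L}_a(x)=ax$, $\mathrm{R}_a(x)=xa$, and $\mathbb{H}^\ast=\mathbb{H}\setminus\{0\}$. $\mathrm{GO}^+(\mathbb{H})$ is the group of proper similitudes of $(\mathbb{H},n)$, i.e. invertible linear maps $\varphi$ with $n(\varphi(x))=\mu(\varphi)n(x)$ for all $x$ and some scalar $\mu(\varphi)$, satisfying $\det\varphi=\mu(\varphi)^2$; $\mathrm{PGO}^+(\mathbb{H})=\mathrm{GO}^+(\mathbb{H})/(\mathbb{R}^\ast\mathbb{I})$, and square brackets denote classes. For every $\varphi\in\mathrm{GO}^+(\mathbb{H})$ there exist $\varphi_1,\varphi_2\in\mathrm{GO}^+(\mathbb{H})$ (triality components of $\varphi$) with $\varphi(xy)=\varphi_1(x)\varphi_2(y)$ for all $x,y\in\mathbb{H}$. For $\lambda\in\mathrm{C}_2$ write $\varphi^\lambda=\lambda\varphi\lambda$ and $\varphi^{-\lambda}=(\varphi^\lambda)^{-1}$. For $s\in\mathbb{H}^\ast$, $c_s=[\mathrm{L}_s\mathrm{R}_s^{-1}]\in\mathrm{PGO}^+(\mathbb{H})$, which depends only on the class of $s$ in $\mathbb{H}^\ast/\mathbb{R}^\ast$. $\mathrm{SPds}(\mathbb{H})$ is the set of positive definite symmetric linear endomorphisms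 of the Euclidean space $\mathbb{H}$ with determinant $1$; $\mathrm{PGO}^+(\mathbb{H})$ acts on it by conjugation with representatives. Elements of $\mathbb{H}^\ast/\mathbb{R}^\ast$ are written by representatives. The group $\mathbb{H}^\ast$ acts on $\mathrm{PGO}^+(\mathbb{H})^2$ by $w\cdot(\zeta,\eta)=([\mathrm{R}_w]^{-1}\zeta,[\mathrm{L}_w]\eta)$; the orbit set is $\mathrm{PGO}^+(\mathbb{H})^2/\mathbb{H}^\ast$, and $[\zeta,\eta]$ denotes the orbit of $(\zeta,\eta)$ (also written with representatives in $\mathrm{GO}^+(\mathbb{H})$). For a group $G$ acting on a set $X$, the groupoid of the action has object class $X$, and morphisms $x\to y$ are the $g\in G$ with $g\cdot x=y$. $\mathscr{Y}(\mathbb{H})$ is the groupoid of the action of $\mathrm{PGO}^+(\mathbb{H})$ on $\mathrm{PGO}^+(\mathbb{H})^2/\mathbb{H}^\ast\times\mathrm{SPds}(\mathbb{H})^2\times\mathrm{C}_2^2$ given by $$[\varphi]\cdot\left([\zeta,\eta],(\delta,\epsilon),(\lambda,\mu)\right)=\left([\varphi_1\zeta\varphi^{-\lambda},\varphi_2\eta\varphi^{-\mu}],(\varphi^\lambda\delta\varphi^{-\lambda},\varphi^\mu\epsilon\varphi^{-\mu}),(\lambda,\mu)\right),$$ with $\varphi_1,\varphi_2$ any pair of triality components of $\varphi$. $\mathscr{Y}(\mathbb{H})_{i,j}$ is the full subcategory of $\mathscr{Y}(\mathbb{H})$ formed by all objects $([\zeta,\eta],(\delta,\epsilon),(\lambda,\mu))$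 such that $\det(\zeta\delta\lambda)$ has sign $i$ and $\det(\eta\epsilon\mu)$ has sign $j$; equivalently, $\lambda=\mathbb{I}$ if $i=1$, $\lambda=\kappa$ if $i=-1$, and $\mu=\mathbb{I}$ if $j=1$, $\mu=\kappa$ if $j=-1$. *)

theory Defs
  imports "HOL-Analysis.Analysis" "HOL-Algebra.Coset" "HOL-Algebra.Group_Action"
begin

text \<open>
  Morphism sets of distinct pairs of objects need not be disjoint, as is usual for the groupoid
  of a group action, where the same group element occurs in many of them. Consequently the
  morphism part of a functor takes the source and the target as additional arguments.
\<close>

record ('o, 'm) cat =
  Obj :: "'o set"
  Mor :: "'o \<Rightarrow> 'o \<Rightarrow> 'm set"
  Ide :: "'o \<Rightarrow> 'm"
  Comp :: "'m \<Rightarrow> 'm \<Rightarrow> 'm"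

locale category =
  fixes C :: "('o, 'm) cat"
  assumes Ide_in: "x \<in> Obj C \<Longrightarrow> Ide C x \<in> Mor C x x"
    and Comp_in: "\<lbrakk>x \<in> Obj C; y \<in> Obj C; z \<in> Obj C; f \<in> Mor C x y; g \<in> Mor C y z\<rbrakk>
      \<Longrightarrow> Comp C g f \<in> Mor C x z"
    and Comp_assoc: "\<lbrakk>w \<in> Obj C; x \<in> Obj C; y \<in> Obj C; z \<in> Obj C;
        f \<in> Mor C w x; g \<in> Mor C x y; h \<in> Mor C y z\<rbrakk>
      \<Longrightarrow> Comp C h (Comp C g f) = Comp C (Comp C h g) f"
    and Comp_Ide_right: "\<lbrakk>x \<in> Obj C; y \<in> Obj C; f \<in> Mor C x y\<rbrakk> \<Longrightarrow> Comp C f (Ide C x) = f"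
    and Comp_Ide_left: "\<lbrakk>x \<in> Obj C; y \<in> Obj C; f \<in> Mor C x y\<rbrakk> \<Longrightarrow> Comp C (Ide C y) f = f"

definition is_iso :: "('o, 'm) cat \<Rightarrow> 'o \<Rightarrow> 'o \<Rightarrow> 'm \<Rightarrow> bool" where
  "is_iso C x y f \<longleftrightarrow> f \<in> Mor C x y \<and>
     (\<exists>g \<in> Mor C y x. Comp C g f = Ide C x \<and> Comp C f g = Ide C y)"

record ('o, 'm, 'p, 'n) fnctr =
  on_obj :: "'o \<Rightarrow> 'p"
  on_mor :: "'o \<Rightarrow> 'o \<Rightarrow> 'm \<Rightarrow> 'n"

definition id_fnctr :: "('o, 'm, 'o, 'm) fnctr" where
  "id_fnctr = \<lparr>on_obj = (\<lambda>x. x), on_mor = (\<lambda>_ _ f. f)\<rparr>"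

definition comp_fnctr ::
    "('p, 'n, 'q, 'k) fnctr \<Rightarrow> ('o, 'm, 'p, 'n) fnctr \<Rightarrow> ('o, 'm, 'q, 'k) fnctr" where
  "comp_fnctr G F =
     \<lparr>on_obj = (\<lambda>x. on_obj G (on_obj F x)),
      on_mor = (\<lambda>x y f. on_mor G (on_obj F x) (on_obj F y) (on_mor F x y f))\<rparr>"

locale cat_functor = C: category C + D: category D
  for C :: "('o, 'm) cat" and D :: "('p, 'n) cat" +
  fixes F :: "('o, 'm, 'p, 'n) fnctr"
  assumes on_obj_in: "x \<in> Obj C \<Longrightarrow> on_obj F x \<in> Obj D"
    and on_mor_in: "\<lbrakk>x \<in> Obj C; y \<in> Obj C; f \<in> Mor C x y\<rbrakk>
      \<Longrightarrow> on_mor F x y f \<in> Mor D (on_obj F x) (on_obj F y)"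
    and on_mor_Ide: "x \<in> Obj C \<Longrightarrow> on_mor F x x (Ide C x) = Ide D (on_obj F x)"
    and on_mor_Comp: "\<lbrakk>x \<in> Obj C; y \<in> Obj C; z \<in> Obj C; f \<in> Mor C x y; g \<in> Mor C y z\<rbrakk>
      \<Longrightarrow> on_mor F x z (Comp C g f) = Comp D (on_mor F y z g) (on_mor F x y f)"

definition natural_iso ::
    "('o, 'm) cat \<Rightarrow> ('p, 'n) cat \<Rightarrow> ('o, 'm, 'p, 'n) fnctr \<Rightarrow> ('o, 'm, 'p, 'n) fnctr
      \<Rightarrow> ('o \<Rightarrow> 'n) \<Rightarrow> bool" where
  "natural_iso C D F G \<tau> \<longleftrightarrow>
     (\<forall>x \<in> Obj C. is_iso D (on_obj F x) (on_obj G x) (\<tau> x)) \<and>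
     (\<forall>x \<in> Obj C. \<forall>y \<in> Obj C. \<forall>f \<in> Mor C x y.
        Comp D (\<tau> y) (on_mor F x y f) = Comp D (on_mor G x y f) (\<tau> x))"

definition is_equivalence ::
    "('o, 'm) cat \<Rightarrow> ('p, 'n) cat \<Rightarrow> ('o, 'm, 'p, 'n) fnctr \<Rightarrow> bool" where
  "is_equivalence C D F \<longleftrightarrow> cat_functor C D F \<and>
     (\<exists>G. cat_functor D C G \<and>
        (\<exists>\<sigma>. natural_iso C C id_fnctr (comp_fnctr G F) \<sigma>) \<and>
        (\<exists>\<tau>. natural_iso D D (comp_fnctr F G) id_fnctr \<tau>))"

definition equivalent_categories :: "('o, 'm) cat \<Rightarrow> ('p, 'n) cat \<Rightarrow> bool" where
  "equivalent_categories C D \<longleftrightarrow> (\<exists>F. is_equivalence C D F)"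

definition full_subcategory :: "('o, 'm) cat \<Rightarrow> 'o set \<Rightarrow> ('o, 'm) cat" where
  "full_subcategory C S = C\<lparr>Obj := Obj C \<inter> S\<rparr>"

definition action_groupoid ::
    "('g, 'b) monoid_scheme \<Rightarrow> 'x set \<Rightarrow> ('g \<Rightarrow> 'x \<Rightarrow> 'x) \<Rightarrow> ('x, 'g) cat" where
  "action_groupoid G X act =
     \<lparr>Obj = X,
      Mor = (\<lambda>x y. {g \<in> carrier G. act g x = y}),
      Ide = (\<lambda>_. \<one>\<^bsub>G\<^esub>),
      Comp = (\<lambda>g h. g \<otimes>\<^bsub>G\<^esub> h)\<rparr>"

text \<open>
  The vector with components \<open>a, b, c, d\<close> stands for \<open>a + b i + c j + d k\<close>, so that the inner
  product of \<open>real^4\<close> is the Euclidean structure belonging to the norm form. The product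
  \<open>qmult\<close> must not be confused with the library's componentwise product on vectors.
\<close>

type_synonym quat = "real^4"

definition qmult :: "quat \<Rightarrow> quat \<Rightarrow> quat"  (infixl \<open>\<odot>\<close> 70) where
  "x \<odot> y = vector
     [x$1 * y$1 - x$2 * y$2 - x$3 * y$3 - x$4 * y$4,
      x$1 * y$2 + x$2 * y$1 + x$3 * y$4 - x$4 * y$3,
      x$1 * y$3 - x$2 * y$4 + x$3 * y$1 + x$4 * y$2,
      x$1 * y$4 + x$2 * y$3 - x$3 * y$2 + x$4 * y$1]"

definition qone :: quat where
  "qone = vector [1, 0, 0, 0]"

definition qcnj :: "quat \<Rightarrow> quat" where
  "qcnj x = vector [x$1, - x$2, - x$3, - x$4]"

text \<open>The product of a quaternion with its conjugate is real, so its first component is all of it.\<close>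

definition qnorm :: "quat \<Rightarrow> real" where
  "qnorm x = (x \<odot> qcnj x) $ 1"

definition Lm :: "quat \<Rightarrow> quat \<Rightarrow> quat" where
  "Lm a = (\<lambda>x. a \<odot> x)"

definition Rm :: "quat \<Rightarrow> quat \<Rightarrow> quat" where
  "Rm a = (\<lambda>x. x \<odot> a)"

definition C2 :: "(quat \<Rightarrow> quat) set" where
  "C2 = {id, qcnj}"

definition Hstar :: "quat monoid" where
  "Hstar = \<lparr>carrier = {x. x \<noteq> 0}, mult = qmult, one = qone\<rparr>"

definition Rstar :: "quat set" where
  "Rstar = {r *\<^sub>R qone | r. r \<noteq> 0}"

definition PHstar :: "quat set monoid" where
  "PHstar = Hstar Mod Rstar"

definition GOp :: "(quat \<Rightarrow> quat) monoid" where
  "GOp =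
     \<lparr>carrier = {\<phi>. linear \<phi> \<and> bij \<phi> \<and>
        (\<exists>\<mu>::real. (\<forall>x. qnorm (\<phi> x) = \<mu> * qnorm x) \<and> det (matrix \<phi>) = \<mu>\<^sup>2)},
      mult = (\<circ>), one = id\<rparr>"

definition homotheties :: "(quat \<Rightarrow> quat) set" where
  "homotheties = {(\<lambda>x. r *\<^sub>R x) | r. r \<noteq> 0}"

definition PGOp :: "(quat \<Rightarrow> quat) set monoid" where
  "PGOp = GOp Mod homotheties"

definition cls :: "(quat \<Rightarrow> quat) \<Rightarrow> (quat \<Rightarrow> quat) set" where
  "cls \<phi> = homotheties #>\<^bsub>GOp\<^esub> \<phi>"

definition triality :: "(quat \<Rightarrow> quat) \<Rightarrow> (quat \<Rightarrow> quat) \<Rightarrow> (quat \<Rightarrow> quat) \<Rightarrow> bool" where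
  "triality \<phi> \<phi>1 \<phi>2 \<longleftrightarrow> \<phi>1 \<in> carrier GOp \<and> \<phi>2 \<in> carrier GOp \<and>
     (\<forall>x y. \<phi> (x \<odot> y) = \<phi>1 x \<odot> \<phi>2 y)"

definition twist :: "(quat \<Rightarrow> quat) \<Rightarrow> (quat \<Rightarrow> quat) \<Rightarrow> quat \<Rightarrow> quat" where
  "twist l \<phi> = l \<circ> \<phi> \<circ> l"

definition conj_by :: "(quat \<Rightarrow> quat) \<Rightarrow> (quat \<Rightarrow> quat) \<Rightarrow> quat \<Rightarrow> quat" where
  "conj_by \<phi> \<delta> = \<phi> \<circ> \<delta> \<circ> inv\<^bsub>GOp\<^esub> \<phi>"

definition SPds :: "(quat \<Rightarrow> quat) set" where
  "SPds = {\<delta>. linear \<delta> \<and> (\<forall>x y. \<delta> x \<bullet> y = x \<bullet> \<delta> y) \<and> (\<forall>x. x \<noteq> 0 \<longrightarrow> \<delta> x \<bullet> x > 0) \<and>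
     det (matrix \<delta>) = 1}"

text \<open>
  The common value of \<open>f\<close> on all representatives of a class. It is unspecified unless \<open>f\<close> is
  constant on the class.
\<close>

definition on_class :: "('a \<Rightarrow> 'b) \<Rightarrow> 'a set \<Rightarrow> 'b" where
  "on_class f A = the_elem (f ` A)"

definition cmap :: "quat set \<Rightarrow> (quat \<Rightarrow> quat) set" where
  "cmap S = on_class (\<lambda>s. cls (Lm s \<circ> inv\<^bsub>GOp\<^esub> (Rm s))) S"

definition SPds_act :: "(quat \<Rightarrow> quat) set \<Rightarrow> (quat \<Rightarrow> quat) \<Rightarrow> quat \<Rightarrow> quat" where
  "SPds_act g \<delta> = on_class (\<lambda>\<phi>. conj_by \<phi> \<delta>) g"

type_synonym pgo = "(quat \<Rightarrow> quat) set"

definition Hstar_act :: "quat \<Rightarrow> pgo \<times> pgo \<Rightarrow> pgo \<times> pgo" where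
  "Hstar_act w = (\<lambda>(\<zeta>, \<eta>). (inv\<^bsub>PGOp\<^esub> (cls (Rm w)) \<otimes>\<^bsub>PGOp\<^esub> \<zeta>, cls (Lm w) \<otimes>\<^bsub>PGOp\<^esub> \<eta>))"

definition orb :: "pgo \<Rightarrow> pgo \<Rightarrow> (pgo \<times> pgo) set" where
  "orb \<zeta> \<eta> = orbit Hstar Hstar_act (\<zeta>, \<eta>)"

type_synonym yobj =
  "(pgo \<times> pgo) set \<times> ((quat \<Rightarrow> quat) \<times> (quat \<Rightarrow> quat)) \<times> ((quat \<Rightarrow> quat) \<times> (quat \<Rightarrow> quat))"

definition Y_objects :: "yobj set" where
  "Y_objects =
     orbits Hstar (carrier PGOp \<times> carrier PGOp) Hstar_act \<times> (SPds \<times> SPds) \<times> (C2 \<times> C2)"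

text \<open>
  The set below collects the results for all choices of a representative \<open>\<phi>\<close> of the acting
  class, of triality components of \<open>\<phi>\<close>, and of a representative of the orbit. The action is
  its unique element.
\<close>

definition Y_act :: "pgo \<Rightarrow> yobj \<Rightarrow> yobj" where
  "Y_act g = (\<lambda>(P, (\<delta>, \<epsilon>), (l, m)). the_elem
     {(orb (cls \<phi>1 \<otimes>\<^bsub>PGOp\<^esub> \<zeta> \<otimes>\<^bsub>PGOp\<^esub> inv\<^bsub>PGOp\<^esub> (cls (twist l \<phi>)))
           (cls \<phi>2 \<otimes>\<^bsub>PGOp\<^esub> \<eta> \<otimes>\<^bsub>PGOp\<^esub> inv\<^bsub>PGOp\<^esub> (cls (twist m \<phi>))),
       (conj_by (twist l \<phi>) \<delta>, conj_by (twist m \<phi>) \<epsilon>),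
       (l, m))
      | \<phi> \<phi>1 \<phi>2 \<zeta> \<eta>. \<phi> \<in> g \<and> triality \<phi> \<phi>1 \<phi>2 \<and> (\<zeta>, \<eta>) \<in> P})"

definition Y_groupoid :: "(yobj, pgo) cat" where
  "Y_groupoid = action_groupoid PGOp Y_objects Y_act"

definition Y_sub :: "int \<Rightarrow> int \<Rightarrow> (yobj, pgo) cat" where
  "Y_sub i j = full_subcategory Y_groupoid
     {(orb (cls \<zeta>) (cls \<eta>), (\<delta>, \<epsilon>), (l, m)) | \<zeta> \<eta> \<delta> \<epsilon> l m.
        \<zeta> \<in> carrier GOp \<and> \<eta> \<in> carrier GOp \<and>
        sgn (det (matrix (\<zeta> \<circ> \<delta> \<circ> l))) = real_of_int i \<and>
        sgn (det (matrix (\<eta> \<circ> \<epsilon> \<circ> m))) = real_of_int j}"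

type_synonym zobj =
  "(quat set \<times> quat set) \<times> ((quat \<Rightarrow> quat) \<times> (quat \<Rightarrow> quat))"

definition Z_act :: "quat set \<Rightarrow> zobj \<Rightarrow> zobj" where
  "Z_act s = (\<lambda>((a, b), (\<delta>, \<epsilon>)).
     ((s \<otimes>\<^bsub>PHstar\<^esub> a \<otimes>\<^bsub>PHstar\<^esub> inv\<^bsub>PHstar\<^esub> s, s \<otimes>\<^bsub>PHstar\<^esub> b \<otimes>\<^bsub>PHstar\<^esub> inv\<^bsub>PHstar\<^esub> s),
      (SPds_act (cmap s) \<delta>, SPds_act (cmap s) \<epsilon>)))"

definition Z_groupoid :: "(zobj, quat set) cat" where
  "Z_groupoid =
     action_groupoid PHstar ((carrier PHstar \<times> carrier PHstar) \<times> (SPds \<times> SPds)) Z_act"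

definition Lcls :: "quat set \<Rightarrow> pgo" where
  "Lcls A = on_class (\<lambda>a. cls (Lm a)) A"

definition Rcls :: "quat set \<Rightarrow> pgo" where
  "Rcls A = on_class (\<lambda>a. cls (Rm a)) A"

definition H_obj :: "int \<Rightarrow> int \<Rightarrow> zobj \<Rightarrow> yobj" where
  "H_obj i j = (\<lambda>((a, b), (\<delta>, \<epsilon>)).
     if (i, j) = (1, 1) then (orb (Lcls a) (Rcls b), (\<delta>, \<epsilon>), (id, id))
     else if (i, j) = (-1, 1) then (orb (Rcls a) (Rcls b), (\<delta>, \<epsilon>), (qcnj, id))
     else if (i, j) = (1, -1) then (orb (Lcls a) (Lcls b), (\<delta>, \<epsilon>), (id, qcnj))
     else (orb (Lcls a) (Rcls b), (\<delta>, \<epsilon>), (qcnj, qcnj)))"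

definition H_functor :: "int \<Rightarrow> int \<Rightarrow> (zobj, quat set, yobj, pgo) fnctr" where
  "H_functor i j = \<lparr>on_obj = H_obj i j, on_mor = (\<lambda>_ _ s. cmap s)\<rparr>"

end

theory Submission
  imports Defs
begin

text \<open>
  Every proper similitude of the quaternions is a two-sided multiplication \<open>x \<mapsto> p x q\<close>
  (\<open>carrier_GOp\<close>), and \<open>p\<close>, \<open>q\<close> are determined up to real scalars by its class
  (\<open>cls_LRm_eq_iff\<close>). Hence a pair \<open>(x \<mapsto> a x c, x \<mapsto> d x b)\<close> of similitudes consists of four
  quaternions modulo scalars, and since \<open>w\<close> replaces \<open>(c, d)\<close> by \<open>(c w\<inverse>, w d)\<close>, its orbit
  under the quaternion units is the triple \<open>(a, c d, b)\<close> modulo scalars (\<open>orb_LRm\<close>,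
  \<open>triple_orbit_eq_iff\<close>).

  In these coordinates the action becomes explicit. Triality components of \<open>x \<mapsto> p x q\<close> are
  \<open>x \<mapsto> p x\<close> and \<open>y \<mapsto> y q\<close>, and any other choice inserts a factor and its inverse in the middle,
  where they cancel. If the twists of \<open>x \<mapsto> p x q\<close> are \<open>x \<mapsto> p\<^sub>1 x q\<^sub>1\<close> and
  \<open>x \<mapsto> p\<^sub>2 x q\<^sub>2\<close>, the triple \<open>(a, m, b)\<close> is sent to
  \<open>(p a p\<^sub>1\<inverse>, q\<^sub>1\<inverse> m p\<^sub>2\<inverse>, q\<^sub>2\<inverse> b q)\<close> (\<open>Y_act_triple_orbit\<close>).
  Twisting by conjugation turns \<open>(p, q)\<close> into \<open>(q\<inverse>, p\<inverse>)\<close> up to scalars, so for each choice of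
  the two signs one of the three entries transforms by \<open>m \<mapsto> p m q\<close> or by
  \<open>m \<mapsto> q\<inverse> m p\<inverse>\<close>. The object map of the functor puts \<open>1\<close> in that entry and \<open>a, b\<close> in the
  other two.

  The theorem is now a change of gauge. Such an entry can be moved to \<open>1\<close> (\<open>H_obj_dense\<close>), so
  the functor is dense. A class that keeps it at \<open>1\<close> has \<open>q = p\<inverse>\<close> up to scalars
  (\<open>H_obj_stabilizer\<close>), so it is the class of a conjugation by \<open>p\<close>, which acts on the other two
  entries by conjugation (\<open>H_obj_equivariant\<close>); so the functor is full. It is faithful because the
  conjugation determines \<open>p\<close> up to scalars.
\<close>

section \<open>Equivalences of categories\<close>

lemma cat_functor_id: "category C \<Longrightarrow> cat_functor C C id_fnctr"
  unfolding cat_functor_def cat_functor_axioms_def by (simp add: id_fnctr_def)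

lemma cat_functor_comp:
  assumes "cat_functor C D F" "cat_functor D E G"
  shows "cat_functor C E (comp_fnctr G F)"
proof -
  interpret F: cat_functor C D F by fact
  interpret G: cat_functor D E G by fact
  show ?thesis
    by unfold_locales
      (simp_all add: comp_fnctr_def F.on_obj_in G.on_obj_in F.on_mor_in G.on_mor_in
        F.on_mor_Ide G.on_mor_Ide F.on_mor_Comp G.on_mor_Comp)
qed

lemma natural_iso_inverse:
  assumes F: "cat_functor C D F" and G: "cat_functor C D G" and nat: "natural_iso C D F G \<tau>"
  shows "\<exists>\<rho>. natural_iso C D G F \<rho>"
proof -
  interpret F: cat_functor C D F by fact
  interpret G: cat_functor C D G by fact
  have "\<exists>r. r \<in> Mor D (on_obj G x) (on_obj F x) \<and> Comp D r (\<tau> x) = Ide D (on_obj F x)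
      \<and> Comp D (\<tau> x) r = Ide D (on_obj G x)" if "x \<in> Obj C" for x
    using nat that unfolding natural_iso_def is_iso_def by blast
  then obtain \<rho> where \<rho>: "\<And>x. x \<in> Obj C \<Longrightarrow> \<rho> x \<in> Mor D (on_obj G x) (on_obj F x)"
      "\<And>x. x \<in> Obj C \<Longrightarrow> Comp D (\<rho> x) (\<tau> x) = Ide D (on_obj F x)"
      "\<And>x. x \<in> Obj C \<Longrightarrow> Comp D (\<tau> x) (\<rho> x) = Ide D (on_obj G x)"
    by metis
  have \<tau>: "\<tau> x \<in> Mor D (on_obj F x) (on_obj G x)" if "x \<in> Obj C" for x
    using nat that unfolding natural_iso_def is_iso_def by blast
  have "Comp D (\<rho> y) (on_mor G x y f) = Comp D (on_mor F x y f) (\<rho> x)"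
    if x: "x \<in> Obj C" and y: "y \<in> Obj C" and f: "f \<in> Mor C x y" for x y f
  proof -
    note Fx = F.on_obj_in[OF x] and Fy = F.on_obj_in[OF y]
      and Gx = G.on_obj_in[OF x] and Gy = G.on_obj_in[OF y]
      and Ff = F.on_mor_in[OF x y f] and Gf = G.on_mor_in[OF x y f]
      and \<tau>x = \<tau>[OF x] and \<tau>y = \<tau>[OF y] and \<rho>x = \<rho>(1)[OF x] and \<rho>y = \<rho>(1)[OF y]
    have square: "Comp D (\<tau> y) (on_mor F x y f) = Comp D (on_mor G x y f) (\<tau> x)"
      using nat x y f unfolding natural_iso_def by blast
    have "Comp D (\<rho> y) (on_mor G x y f)
        = Comp D (\<rho> y) (Comp D (Comp D (on_mor G x y f) (\<tau> x)) (\<rho> x))"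
      using F.D.Comp_assoc[OF Gx Fx Gx Gy \<rho>x \<tau>x Gf] F.D.Comp_Ide_right[OF Gx Gy Gf]
        \<rho>(3)[OF x] by simp
    also have "\<dots> = Comp D (\<rho> y) (Comp D (\<tau> y) (Comp D (on_mor F x y f) (\<rho> x)))"
      using F.D.Comp_assoc[OF Gx Fx Fy Gy \<rho>x Ff \<tau>y] square by simp
    also have "\<dots> = Comp D (on_mor F x y f) (\<rho> x)"
      using F.D.Comp_assoc[OF Gx Fy Gy Fy F.D.Comp_in[OF Gx Fx Fy \<rho>x Ff] \<tau>y \<rho>y]
        F.D.Comp_Ide_left[OF Gx Fy F.D.Comp_in[OF Gx Fx Fy \<rho>x Ff]] \<rho>(2)[OF y] by simp
    finally show ?thesis .
  qed
  moreover have "is_iso D (on_obj G x) (on_obj F x) (\<rho> x)" if "x \<in> Obj C" for x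
    using \<rho> \<tau> that unfolding is_iso_def by blast
  ultimately show ?thesis
    unfolding natural_iso_def by blast
qed

lemma is_equivalence_imp_equivalent_categories_sym:
  assumes "is_equivalence C D F"
  shows "equivalent_categories D C"
proof -
  obtain G \<sigma> \<tau> where F: "cat_functor C D F" and G: "cat_functor D C G"
    and \<sigma>: "natural_iso C C id_fnctr (comp_fnctr G F) \<sigma>"
    and \<tau>: "natural_iso D D (comp_fnctr F G) id_fnctr \<tau>"
    using assms unfolding is_equivalence_def by blast
  have "category C" "category D"
    using F by (simp_all add: cat_functor_def)
  then have "\<exists>\<rho>. natural_iso C C (comp_fnctr G F) id_fnctr \<rho>"
    and "\<exists>\<rho>. natural_iso D D id_fnctr (comp_fnctr F G) \<rho>"
    using \<sigma> \<tau> F G by (blast intro: natural_iso_inverse cat_functor_id cat_functor_comp)+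
  then show ?thesis
    unfolding equivalent_categories_def is_equivalence_def using F G by blast
qed

text \<open>
  A quasi-inverse is obtained by choosing an isomorphism \<open>\<tau> d : F (G d) \<rightarrow> d\<close> for each \<open>d\<close> and letting
  \<open>G g\<close> be the unique lift of \<open>g\<close> transported along \<open>\<tau>\<close>. Functoriality and naturality are then
  equations between images under \<open>F\<close>, where faithfulness permits to check them.
\<close>

lemma is_equivalence_if_fully_faithful_dense:
  assumes F: "cat_functor C D F"
    and ff: "\<And>x y g. \<lbrakk>x \<in> Obj C; y \<in> Obj C; g \<in> Mor D (on_obj F x) (on_obj F y)\<rbrakk>
      \<Longrightarrow> \<exists>!f. f \<in> Mor C x y \<and> on_mor F x y f = g"
    and dense: "\<And>d. d \<in> Obj D \<Longrightarrow> \<exists>c \<in> Obj C. \<exists>t. is_iso D (on_obj F c) d t"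
  shows "is_equivalence C D F"
proof -
  interpret F: cat_functor C D F by fact
  obtain G0 \<tau> where G0: "\<And>d. d \<in> Obj D \<Longrightarrow> G0 d \<in> Obj C"
    and \<tau>_iso: "\<And>d. d \<in> Obj D \<Longrightarrow> is_iso D (on_obj F (G0 d)) d (\<tau> d)"
    using dense by metis
  have \<tau>: "\<tau> d \<in> Mor D (on_obj F (G0 d)) d" if "d \<in> Obj D" for d
    using \<tau>_iso[OF that] by (simp add: is_iso_def)
  obtain \<rho> where \<rho>: "\<And>d. d \<in> Obj D \<Longrightarrow> \<rho> d \<in> Mor D d (on_obj F (G0 d))"
      "\<And>d. d \<in> Obj D \<Longrightarrow> Comp D (\<rho> d) (\<tau> d) = Ide D (on_obj F (G0 d))"
      "\<And>d. d \<in> Obj D \<Longrightarrow> Comp D (\<tau> d) (\<rho> d) = Ide D d"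
    using \<tau>_iso unfolding is_iso_def by metis
  define lift where "lift x y g = (THE f. f \<in> Mor C x y \<and> on_mor F x y f = g)" for x y g
  have lift: "lift x y g \<in> Mor C x y" "on_mor F x y (lift x y g) = g"
    if "x \<in> Obj C" "y \<in> Obj C" "g \<in> Mor D (on_obj F x) (on_obj F y)" for x y g
    using theI'[OF ff[OF that]] by (simp_all add: lift_def)
  have faithful: "f = f'"
    if "x \<in> Obj C" "y \<in> Obj C" "f \<in> Mor C x y" "f' \<in> Mor C x y"
      "on_mor F x y f = on_mor F x y f'" for x y f f'
    using ff[OF that(1,2) F.on_mor_in[OF that(1,2,3)]] that by metis
  define conj where "conj d e g = Comp D (\<rho> e) (Comp D g (\<tau> d))" for d e g
  have conj_in: "conj d e g \<in> Mor D (on_obj F (G0 d)) (on_obj F (G0 e))"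
    if "d \<in> Obj D" "e \<in> Obj D" "g \<in> Mor D d e" for d e g
    unfolding conj_def
    by (rule F.D.Comp_in[OF F.on_obj_in[OF G0[OF that(1)]] that(2) F.on_obj_in[OF G0[OF that(2)]]
          F.D.Comp_in[OF F.on_obj_in[OF G0[OF that(1)]] that(1,2) \<tau>[OF that(1)] that(3)]
          \<rho>(1)[OF that(2)]])
  have \<tau>_conj: "Comp D (\<tau> e) (conj d e g) = Comp D g (\<tau> d)"
    if "d \<in> Obj D" "e \<in> Obj D" "g \<in> Mor D d e" for d e g
  proof -
    note Fd = F.on_obj_in[OF G0[OF that(1)]] and Fe = F.on_obj_in[OF G0[OF that(2)]]
    have g\<tau>: "Comp D g (\<tau> d) \<in> Mor D (on_obj F (G0 d)) e"
      by (rule F.D.Comp_in[OF Fd that(1,2) \<tau>[OF that(1)] that(3)])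
    show ?thesis
      unfolding conj_def
      using F.D.Comp_assoc[OF Fd that(2) Fe that(2) g\<tau> \<rho>(1)[OF that(2)] \<tau>[OF that(2)]]
        \<rho>(3)[OF that(2)] F.D.Comp_Ide_left[OF Fd that(2) g\<tau>] by simp
  qed
  \<comment> \<open>A morphism into \<open>F (G0 e)\<close> is determined by its composite with the isomorphism \<open>\<tau> e\<close>.\<close>
  have \<tau>_cancel: "h = h'"
    if d: "d \<in> Obj D" and e: "e \<in> Obj D" and h: "h \<in> Mor D d (on_obj F (G0 e))"
      and h': "h' \<in> Mor D d (on_obj F (G0 e))"
      and eq: "Comp D (\<tau> e) h = Comp D (\<tau> e) h'" for d e h h'
  proof -
    have "Comp D (\<rho> e) (Comp D (\<tau> e) k) = k" if k: "k \<in> Mor D d (on_obj F (G0 e))" for k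
      using F.D.Comp_assoc[OF d F.on_obj_in[OF G0[OF e]] e F.on_obj_in[OF G0[OF e]]
          k \<tau>[OF e] \<rho>(1)[OF e]]
        \<rho>(2)[OF e] F.D.Comp_Ide_left[OF d F.on_obj_in[OF G0[OF e]] k] by simp
    then show ?thesis
      using eq h h' by metis
  qed
  define G where "G = \<lparr>on_obj = G0, on_mor = (\<lambda>d e g. lift (G0 d) (G0 e) (conj d e g))\<rparr>"
  have G_mor: "on_mor G d e g \<in> Mor C (G0 d) (G0 e)"
      "on_mor F (G0 d) (G0 e) (on_mor G d e g) = conj d e g"
    if "d \<in> Obj D" "e \<in> Obj D" "g \<in> Mor D d e" for d e g
    using lift conj_in G0 that by (simp_all add: G_def)
  have G_obj [simp]: "on_obj G = G0"
    by (simp add: G_def)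
  have functor_G: "cat_functor D C G"
  proof
    fix d assume d: "d \<in> Obj D"
    show "on_obj G d \<in> Obj C"
      using G0 d by simp
    have "conj d d (Ide D d) = Ide D (on_obj F (G0 d))"
      using F.D.Comp_Ide_left[OF F.on_obj_in[OF G0[OF d]] d \<tau>[OF d]] \<rho>(2)[OF d]
      by (simp add: conj_def)
    then show "on_mor G d d (Ide D d) = Ide C (on_obj G d)"
      using faithful[OF G0[OF d] G0[OF d] G_mor(1)[OF d d F.D.Ide_in[OF d]] F.C.Ide_in[OF G0[OF d]]]
        G_mor(2)[OF d d F.D.Ide_in[OF d]] F.on_mor_Ide[OF G0[OF d]] by simp
  next
    fix d e g assume "d \<in> Obj D" "e \<in> Obj D" "g \<in> Mor D d e"
    then show "on_mor G d e g \<in> Mor C (on_obj G d) (on_obj G e)"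
      using G_mor by simp
  next
    fix c d e f g
    assume c: "c \<in> Obj D" and d: "d \<in> Obj D" and e: "e \<in> Obj D"
      and f: "f \<in> Mor D c d" and g: "g \<in> Mor D d e"
    let ?F = "on_obj F"
    note obj = F.on_obj_in[OF G0[OF c]] F.on_obj_in[OF G0[OF d]] F.on_obj_in[OF G0[OF e]]
    have gf: "Comp D g f \<in> Mor D c e"
      using F.D.Comp_in c d e f g by blast
    have cc: "Comp D (conj d e g) (conj c d f) \<in> Mor D (?F (G0 c)) (?F (G0 e))"
      using F.D.Comp_in[OF obj conj_in[OF c d f] conj_in[OF d e g]] .
    have "Comp D (\<tau> e) (Comp D (conj d e g) (conj c d f))
        = Comp D (Comp D (\<tau> e) (conj d e g)) (conj c d f)"
      by (rule F.D.Comp_assoc[OF obj(1,2,3) e conj_in[OF c d f] conj_in[OF d e g] \<tau>[OF e]])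
    also have "\<dots> = Comp D g (Comp D (\<tau> d) (conj c d f))"
      using F.D.Comp_assoc[OF obj(1,2) d e conj_in[OF c d f] \<tau>[OF d] g] \<tau>_conj[OF d e g] by simp
    also have "\<dots> = Comp D (\<tau> e) (conj c e (Comp D g f))"
      using F.D.Comp_assoc[OF obj(1) c d e \<tau>[OF c] f g] \<tau>_conj[OF c d f] \<tau>_conj[OF c e gf]
      by simp
    finally have "Comp D (conj d e g) (conj c d f) = conj c e (Comp D g f)"
      using \<tau>_cancel[OF obj(1) e cc conj_in[OF c e gf]] by simp
    then have "on_mor F (G0 c) (G0 e) (on_mor G c e (Comp D g f))
        = on_mor F (G0 c) (G0 e) (Comp C (on_mor G d e g) (on_mor G c d f))"
      using F.on_mor_Comp[OF G0[OF c] G0[OF d] G0[OF e] G_mor(1)[OF c d f] G_mor(1)[OF d e g]]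
        G_mor(2) c d e f g gf by simp
    then show "on_mor G c e (Comp D g f) = Comp C (on_mor G d e g) (on_mor G c d f)"
      using faithful[OF G0[OF c] G0[OF e] G_mor(1)[OF c e gf]]
        F.C.Comp_in[OF G0[OF c] G0[OF d] G0[OF e] G_mor(1)[OF c d f] G_mor(1)[OF d e g]]
      by blast
  qed
  have nat_\<tau>: "natural_iso D D (comp_fnctr F G) id_fnctr \<tau>"
    unfolding natural_iso_def using \<tau>_iso \<tau>_conj G_mor(2)
    by (auto simp: comp_fnctr_def id_fnctr_def)
  define \<sigma> where "\<sigma> x = lift x (G0 (on_obj F x)) (\<rho> (on_obj F x))" for x
  have \<sigma>: "\<sigma> x \<in> Mor C x (G0 (on_obj F x))"
      "on_mor F x (G0 (on_obj F x)) (\<sigma> x) = \<rho> (on_obj F x)" if "x \<in> Obj C" for x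
    using lift[OF that G0[OF F.on_obj_in[OF that]] \<rho>(1)[OF F.on_obj_in[OF that]]]
    by (simp_all add: \<sigma>_def)
  have \<sigma>_iso: "is_iso C x (G0 (on_obj F x)) (\<sigma> x)" if x: "x \<in> Obj C" for x
  proof -
    let ?y = "on_obj F x"
    have y: "?y \<in> Obj D" and z: "G0 ?y \<in> Obj C"
      using x F.on_obj_in G0 by auto
    let ?s = "lift (G0 ?y) x (\<tau> ?y)"
    have s: "?s \<in> Mor C (G0 ?y) x" "on_mor F (G0 ?y) x ?s = \<tau> ?y"
      using lift[OF z x \<tau>[OF y]] by auto
    have "Comp C ?s (\<sigma> x) = Ide C x"
      by (rule faithful[OF x x F.C.Comp_in[OF x z x \<sigma>(1)[OF x] s(1)] F.C.Ide_in[OF x]])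
        (simp add: F.on_mor_Comp[OF x z x \<sigma>(1)[OF x] s(1)] s(2) \<sigma>(2)[OF x] \<rho>(3)[OF y]
          F.on_mor_Ide[OF x])
    moreover have "Comp C (\<sigma> x) ?s = Ide C (G0 ?y)"
      by (rule faithful[OF z z F.C.Comp_in[OF z x z s(1) \<sigma>(1)[OF x]] F.C.Ide_in[OF z]])
        (simp add: F.on_mor_Comp[OF z x z s(1) \<sigma>(1)[OF x]] s(2) \<sigma>(2)[OF x] \<rho>(2)[OF y]
          F.on_mor_Ide[OF z])
    ultimately show ?thesis
      unfolding is_iso_def using \<sigma>(1)[OF x] s(1) by blast
  qed
  have \<sigma>_nat: "Comp C (\<sigma> y) f = Comp C (on_mor G (on_obj F x) (on_obj F y) (on_mor F x y f)) (\<sigma> x)"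
    if x: "x \<in> Obj C" and y: "y \<in> Obj C" and f: "f \<in> Mor C x y" for x y f
  proof -
    let ?Fx = "on_obj F x" and ?Fy = "on_obj F y" and ?g = "on_mor F x y f"
    have Fx: "?Fx \<in> Obj D" and Fy: "?Fy \<in> Obj D"
      and g: "?g \<in> Mor D ?Fx ?Fy" and zx: "G0 ?Fx \<in> Obj C" and zy: "G0 ?Fy \<in> Obj C"
      using x y f F.on_obj_in F.on_mor_in G0 by auto
    note Gg = G_mor[OF Fx Fy g]
    have l: "Comp C (\<sigma> y) f \<in> Mor C x (G0 ?Fy)"
      by (rule F.C.Comp_in[OF x y zy f \<sigma>(1)[OF y]])
    have r: "Comp C (on_mor G ?Fx ?Fy ?g) (\<sigma> x) \<in> Mor C x (G0 ?Fy)"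
      by (rule F.C.Comp_in[OF x zx zy \<sigma>(1)[OF x] Gg(1)])
    have "Comp D (\<tau> ?Fy) (Comp D (\<rho> ?Fy) ?g) = ?g"
      using F.D.Comp_assoc[OF Fx Fy F.on_obj_in[OF zy] Fy g \<rho>(1)[OF Fy] \<tau>[OF Fy]]
        \<rho>(3)[OF Fy] F.D.Comp_Ide_left[OF Fx Fy g] by simp
    moreover have "Comp D (\<tau> ?Fy) (Comp D (conj ?Fx ?Fy ?g) (\<rho> ?Fx)) = ?g"
    proof -
      have "Comp D (\<tau> ?Fy) (Comp D (conj ?Fx ?Fy ?g) (\<rho> ?Fx))
          = Comp D (Comp D ?g (\<tau> ?Fx)) (\<rho> ?Fx)"
        using F.D.Comp_assoc[OF Fx F.on_obj_in[OF zx] F.on_obj_in[OF zy] Fy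
            \<rho>(1)[OF Fx] conj_in[OF Fx Fy g] \<tau>[OF Fy]] \<tau>_conj[OF Fx Fy g] by simp
      also have "\<dots> = ?g"
        using F.D.Comp_assoc[OF Fx F.on_obj_in[OF zx] Fx Fy \<rho>(1)[OF Fx] \<tau>[OF Fx] g]
          \<rho>(3)[OF Fx] F.D.Comp_Ide_right[OF Fx Fy g] by simp
      finally show ?thesis .
    qed
    ultimately have "Comp D (\<rho> ?Fy) ?g = Comp D (conj ?Fx ?Fy ?g) (\<rho> ?Fx)"
      using \<tau>_cancel[OF Fx Fy F.D.Comp_in[OF Fx Fy F.on_obj_in[OF zy] g \<rho>(1)[OF Fy]]
          F.D.Comp_in[OF Fx F.on_obj_in[OF zx] F.on_obj_in[OF zy]
            \<rho>(1)[OF Fx] conj_in[OF Fx Fy g]]] by simp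
    then show ?thesis
      by (intro faithful[OF x zy l r])
        (simp add: F.on_mor_Comp[OF x y zy f \<sigma>(1)[OF y]]
          F.on_mor_Comp[OF x zx zy \<sigma>(1)[OF x] Gg(1)] \<sigma>(2)[OF x] \<sigma>(2)[OF y] Gg(2))
  qed
  have nat_\<sigma>: "natural_iso C C id_fnctr (comp_fnctr G F) \<sigma>"
    unfolding natural_iso_def using \<sigma>_iso \<sigma>_nat by (auto simp: comp_fnctr_def id_fnctr_def)
  show ?thesis
    unfolding is_equivalence_def using F functor_G nat_\<sigma> nat_\<tau> by blast
qed

lemma full_subcategory_action_groupoid:
  "full_subcategory (action_groupoid G X act) S = action_groupoid G (X \<inter> S) act"
  by (simp add: full_subcategory_def action_groupoid_def)

lemma category_action_groupoid:
  assumes "group G"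
    and one: "\<And>x. x \<in> X \<Longrightarrow> act \<one>\<^bsub>G\<^esub> x = x"
    and mult: "\<And>g h x. \<lbrakk>g \<in> carrier G; h \<in> carrier G; x \<in> X\<rbrakk>
      \<Longrightarrow> act (g \<otimes>\<^bsub>G\<^esub> h) x = act g (act h x)"
  shows "category (action_groupoid G X act)"
proof -
  interpret group G by fact
  show ?thesis
    by unfold_locales (auto simp: action_groupoid_def one mult m_assoc)
qed

text \<open>
  The previous criterion, read off for groupoids of actions. Injectivity of \<open>h\<close> makes the functor
  faithful. Moving a point into the image of \<open>F\<close> suffices for density because group elements act
  invertibly, so every morphism is an isomorphism.
\<close>

lemma is_equivalence_action_groupoids:
  assumes G: "group G" and K: "group K"
    and actG: "\<And>x. x \<in> X \<Longrightarrow> actG \<one>\<^bsub>G\<^esub> x = x"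
      "\<And>g h x. \<lbrakk>g \<in> carrier G; h \<in> carrier G; x \<in> X\<rbrakk> \<Longrightarrow> actG (g \<otimes>\<^bsub>G\<^esub> h) x = actG g (actG h x)"
    and actK: "\<And>y. y \<in> Y \<Longrightarrow> actK \<one>\<^bsub>K\<^esub> y = y"
      "\<And>g h y. \<lbrakk>g \<in> carrier K; h \<in> carrier K; y \<in> Y\<rbrakk> \<Longrightarrow> actK (g \<otimes>\<^bsub>K\<^esub> h) y = actK g (actK h y)"
    and hom: "h \<in> hom G K" and inj: "inj_on h (carrier G)"
    and F: "\<And>x. x \<in> X \<Longrightarrow> F x \<in> Y"
    and equivariant: "\<And>g x. \<lbrakk>g \<in> carrier G; x \<in> X\<rbrakk> \<Longrightarrow> actK (h g) (F x) = F (actG g x)"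
    and full: "\<And>k x x'. \<lbrakk>k \<in> carrier K; x \<in> X; x' \<in> X; actK k (F x) = F x'\<rbrakk>
      \<Longrightarrow> \<exists>g \<in> carrier G. h g = k \<and> actG g x = x'"
    and dense: "\<And>y. y \<in> Y \<Longrightarrow> \<exists>k \<in> carrier K. \<exists>x \<in> X. actK k y = F x"
  shows "is_equivalence (action_groupoid G X actG) (action_groupoid K Y actK)
    \<lparr>on_obj = F, on_mor = (\<lambda>_ _. h)\<rparr>"
proof -
  let ?C = "action_groupoid G X actG" and ?D = "action_groupoid K Y actK"
  let ?F = "\<lparr>on_obj = F, on_mor = (\<lambda>_ _. h)\<rparr>"
  interpret C: category ?C using G actG by (rule category_action_groupoid)
  interpret D: category ?D using K actK by (rule category_action_groupoid)
  interpret h: group_hom G K h using G K hom by (simp add: group_hom_def group_hom_axioms_def)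
  interpret F: cat_functor ?C ?D ?F
    by unfold_locales (auto simp: action_groupoid_def F equivariant)
  show ?thesis
  proof (rule is_equivalence_if_fully_faithful_dense[OF F.cat_functor_axioms])
    fix x y k assume "x \<in> Obj ?C" "y \<in> Obj ?C" "k \<in> Mor ?D (on_obj ?F x) (on_obj ?F y)"
    then show "\<exists>!g. g \<in> Mor ?C x y \<and> on_mor ?F x y g = k"
      using full[of k x y] inj by (auto simp: action_groupoid_def inj_on_def)
  next
    fix y assume "y \<in> Obj ?D"
    then have y: "y \<in> Y" by (simp add: action_groupoid_def)
    then obtain k x where k: "k \<in> carrier K" and x: "x \<in> X" and eq: "actK k y = F x"
      using dense by blast
    let ?t = "inv\<^bsub>K\<^esub> k"
    have "actK ?t (F x) = y"
      using actK(2)[of ?t k y] actK(1)[OF y] k y eq by simp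
    then have "is_iso ?D (F x) y ?t"
      unfolding is_iso_def using k eq by (auto simp: action_groupoid_def)
    then show "\<exists>x \<in> Obj ?C. \<exists>t. is_iso ?D (on_obj ?F x) y t"
      using x by (auto simp: action_groupoid_def)
  qed
qed

section \<open>The algebra of quaternions\<close>

lemma vector_4_nth [simp]:
  "(vector [a, b, c, d] :: 'a::zero^4) $ 1 = a" "(vector [a, b, c, d] :: 'a^4) $ 2 = b"
  "(vector [a, b, c, d] :: 'a^4) $ 3 = c" "(vector [a, b, c, d] :: 'a^4) $ 4 = d"
  by (simp_all add: vector_def)

lemma quat_eq_iff: "(x :: quat) = y \<longleftrightarrow> x$1 = y$1 \<and> x$2 = y$2 \<and> x$3 = y$3 \<and> x$4 = y$4"
  by (simp add: vec_eq_iff forall_4)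

lemma qmult_nth [simp]:
  "(x \<odot> y) $ 1 = x$1 * y$1 - x$2 * y$2 - x$3 * y$3 - x$4 * y$4"
  "(x \<odot> y) $ 2 = x$1 * y$2 + x$2 * y$1 + x$3 * y$4 - x$4 * y$3"
  "(x \<odot> y) $ 3 = x$1 * y$3 - x$2 * y$4 + x$3 * y$1 + x$4 * y$2"
  "(x \<odot> y) $ 4 = x$1 * y$4 + x$2 * y$3 - x$3 * y$2 + x$4 * y$1"
  by (simp_all add: qmult_def)

lemma qone_nth [simp]: "qone $ 1 = 1" "qone $ 2 = 0" "qone $ 3 = 0" "qone $ 4 = 0"
  by (simp_all add: qone_def)

lemma qcnj_nth [simp]:
  "qcnj x $ 1 = x$1" "qcnj x $ 2 = - x$2" "qcnj x $ 3 = - x$3" "qcnj x $ 4 = - x$4"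
  by (simp_all add: qcnj_def)

lemma qnorm_eq: "qnorm x = (x$1)\<^sup>2 + (x$2)\<^sup>2 + (x$3)\<^sup>2 + (x$4)\<^sup>2"
  by (simp add: qnorm_def power2_eq_square)

lemma inner_quat: "(x :: quat) \<bullet> y = x$1 * y$1 + x$2 * y$2 + x$3 * y$3 + x$4 * y$4"
  by (simp add: inner_vec_def sum_4)

lemma qnorm_inner: "qnorm x = x \<bullet> x"
  by (simp add: qnorm_eq inner_quat power2_eq_square)

lemma qmult_assoc: "x \<odot> y \<odot> z = x \<odot> (y \<odot> z)"
  by (simp add: quat_eq_iff algebra_simps)

lemma qmult_one [simp]: "qone \<odot> x = x" "x \<odot> qone = x"
  by (simp_all add: quat_eq_iff)

lemma qmult_zero [simp]: "0 \<odot> x = 0" "x \<odot> 0 = 0"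
  by (simp_all add: quat_eq_iff)

lemma qmult_scaleR [simp]: "(r *\<^sub>R x) \<odot> y = r *\<^sub>R (x \<odot> y)" "x \<odot> (r *\<^sub>R y) = r *\<^sub>R (x \<odot> y)"
  by (simp_all add: quat_eq_iff algebra_simps)

lemma qmult_add: "(x + y) \<odot> z = x \<odot> z + y \<odot> z" "z \<odot> (x + y) = z \<odot> x + z \<odot> y"
  by (simp_all add: quat_eq_iff algebra_simps)

lemma qmult_diff: "(x - y) \<odot> z = x \<odot> z - y \<odot> z" "z \<odot> (x - y) = z \<odot> x - z \<odot> y"
  by (simp_all add: quat_eq_iff algebra_simps)

lemma qmult_minus [simp]: "(- x) \<odot> y = - (x \<odot> y)" "x \<odot> (- y) = - (x \<odot> y)"
  by (simp_all add: quat_eq_iff)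

lemma qcnj_qcnj [simp]: "qcnj (qcnj x) = x"
  by (simp add: quat_eq_iff)

lemma qcnj_mult: "qcnj (x \<odot> y) = qcnj y \<odot> qcnj x"
  by (simp add: quat_eq_iff algebra_simps)

lemma qcnj_scaleR: "qcnj (r *\<^sub>R x) = r *\<^sub>R qcnj x"
  by (simp add: quat_eq_iff)

lemma qnorm_mult: "qnorm (x \<odot> y) = qnorm x * qnorm y"
  by (simp add: qnorm_eq power2_eq_square algebra_simps)

lemma qnorm_cnj [simp]: "qnorm (qcnj x) = qnorm x"
  by (simp add: qnorm_eq)

lemma qnorm_one [simp]: "qnorm qone = 1"
  by (simp add: qnorm_eq)

lemma qnorm_eq_0_iff [simp]: "qnorm x = 0 \<longleftrightarrow> x = 0"
  by (simp add: qnorm_inner)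

lemma qnorm_pos [simp]: "x \<noteq> 0 \<Longrightarrow> qnorm x > 0"
  by (simp add: qnorm_inner)

lemma qone_neq_0 [simp]: "qone \<noteq> 0"
  by (simp add: quat_eq_iff)

lemma qmult_cnj: "x \<odot> qcnj x = qnorm x *\<^sub>R qone" "qcnj x \<odot> x = qnorm x *\<^sub>R qone"
  by (simp_all add: quat_eq_iff qnorm_eq power2_eq_square)

lemma qmult_eq_0_iff [simp]: "x \<odot> y = 0 \<longleftrightarrow> x = 0 \<or> y = 0"
  using qnorm_mult[of x y] by (metis mult_eq_0_iff qnorm_eq_0_iff)

lemma qcnj_eq_0_iff [simp]: "qcnj x = 0 \<longleftrightarrow> x = 0"
  by (metis qnorm_cnj qnorm_eq_0_iff)

definition qinv :: "quat \<Rightarrow> quat" where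
  "qinv x = inverse (qnorm x) *\<^sub>R qcnj x"

lemma qinv_eq_0_iff [simp]: "qinv x = 0 \<longleftrightarrow> x = 0"
  by (simp add: qinv_def)

lemma qmult_qinv [simp]:
  assumes "x \<noteq> 0"
  shows "x \<odot> qinv x = qone" "qinv x \<odot> x = qone" "x \<odot> (qinv x \<odot> y) = y" "qinv x \<odot> (x \<odot> y) = y"
proof -
  show 1: "x \<odot> qinv x = qone" "qinv x \<odot> x = qone"
    using assms by (simp_all add: qinv_def qmult_cnj)
  show "x \<odot> (qinv x \<odot> y) = y" "qinv x \<odot> (x \<odot> y) = y"
    using 1 by (simp_all add: qmult_assoc[symmetric])
qed

lemma qinv_unique:
  assumes "x \<odot> y = qone"
  shows "qinv x = y"
proof -
  have "x \<noteq> 0"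
    using assms by auto
  then have "qinv x \<odot> (x \<odot> y) = y"
    by simp
  with assms show ?thesis
    by simp
qed

lemma qinv_one [simp]: "qinv qone = qone"
  by (simp add: qinv_unique)

lemma qinv_qinv [simp]: "x \<noteq> 0 \<Longrightarrow> qinv (qinv x) = x"
  by (simp add: qinv_unique)

lemma qinv_mult: "x \<noteq> 0 \<Longrightarrow> y \<noteq> 0 \<Longrightarrow> qinv (x \<odot> y) = qinv y \<odot> qinv x"
  by (simp add: qinv_unique qmult_assoc)

lemma qinv_scaleR: "r \<noteq> 0 \<Longrightarrow> x \<noteq> 0 \<Longrightarrow> qinv (r *\<^sub>R x) = inverse r *\<^sub>R qinv x"
  by (simp add: qinv_unique)

lemma qcnj_eq_qinv: "x \<noteq> 0 \<Longrightarrow> qcnj x = qnorm x *\<^sub>R qinv x"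
  by (simp add: qinv_def)

lemma qinv_cnj: "qinv (qcnj x) = qcnj (qinv x)"
  by (simp add: qinv_def quat_eq_iff)

text \<open>
  Commuting with \<open>i\<close> and \<open>j\<close> already makes the imaginary part vanish.
\<close>

lemma qmult_central_imp_real:
  assumes "\<And>x. a \<odot> x = x \<odot> a"
  shows "a = (a$1) *\<^sub>R qone"
  using assms[of "axis 2 1"] assms[of "axis 3 1"]
  by (simp add: quat_eq_iff axis_def)

definition proportional :: "quat \<Rightarrow> quat \<Rightarrow> bool"  (infix \<open>\<sim>\<close> 50) where
  "x \<sim> y \<longleftrightarrow> (\<exists>r. r \<noteq> 0 \<and> x = r *\<^sub>R y)"

lemma proportional_refl [simp]: "x \<sim> x"
  unfolding proportional_def by (rule exI[of _ 1]) simp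

lemma proportional_sym: "x \<sim> y \<Longrightarrow> y \<sim> x"
  unfolding proportional_def by (metis inverse_nonzero_iff_nonzero scaleR_left_imp_eq
      scaleR_one scaleR_scaleR left_inverse)

lemma proportional_trans [trans]: "x \<sim> y \<Longrightarrow> y \<sim> z \<Longrightarrow> x \<sim> z"
  unfolding proportional_def by (metis mult_eq_0_iff scaleR_scaleR)

lemma proportional_scaleR [simp]: "r \<noteq> 0 \<Longrightarrow> r *\<^sub>R x \<sim> y \<longleftrightarrow> x \<sim> y"
    "r \<noteq> 0 \<Longrightarrow> x \<sim> r *\<^sub>R y \<longleftrightarrow> x \<sim> y"
proof -
  assume r: "r \<noteq> 0"
  have *: "r *\<^sub>R z \<sim> z" for z
    unfolding proportional_def using r by blast
  show "r *\<^sub>R x \<sim> y \<longleftrightarrow> x \<sim> y" "x \<sim> r *\<^sub>R y \<longleftrightarrow> x \<sim> y"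
    using * proportional_sym proportional_trans by meson+
qed

lemma proportional_mult: "x \<sim> x' \<Longrightarrow> y \<sim> y' \<Longrightarrow> x \<odot> y \<sim> x' \<odot> y'"
  unfolding proportional_def by (metis mult_eq_0_iff qmult_scaleR scaleR_scaleR)

lemma proportional_mult_left: "a \<noteq> 0 \<Longrightarrow> a \<odot> x \<sim> a \<odot> y \<longleftrightarrow> x \<sim> y"
  by (metis proportional_mult proportional_refl qmult_qinv(4))

lemma proportional_mult_right: "a \<noteq> 0 \<Longrightarrow> x \<odot> a \<sim> y \<odot> a \<longleftrightarrow> x \<sim> y"
  by (metis proportional_mult proportional_refl qmult_assoc qmult_one(2) qmult_qinv(1))

lemma proportional_qinv: "x \<sim> y \<Longrightarrow> y \<noteq> 0 \<Longrightarrow> qinv x \<sim> qinv y"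
  unfolding proportional_def by (metis inverse_nonzero_iff_nonzero qinv_scaleR)

lemma proportional_mult_eq_one_iff: "x \<noteq> 0 \<Longrightarrow> x \<odot> y \<sim> qone \<longleftrightarrow> y \<sim> qinv x"
  by (metis proportional_mult_left qmult_qinv(1))

lemma proportional_neq_0: "x \<sim> y \<Longrightarrow> x \<noteq> 0 \<longleftrightarrow> y \<noteq> 0"
  by (auto simp: proportional_def)

text \<open>
  For nonzero \<open>a\<close> and \<open>b\<close> these maps are all the proper similitudes (\<open>carrier_GOp\<close>). Every computation with similitudes
  thereby becomes one with the pair \<open>(a, b)\<close>.
\<close>

definition LRm :: "quat \<Rightarrow> quat \<Rightarrow> quat \<Rightarrow> quat" where
  "LRm a b = (\<lambda>x. a \<odot> x \<odot> b)"

lemma Lm_eq_LRm: "Lm a = LRm a qone" and Rm_eq_LRm: "Rm b = LRm qone b"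
  by (simp_all add: Lm_def Rm_def LRm_def)

lemma LRm_one [simp]: "LRm qone qone = id"
  by (simp add: LRm_def fun_eq_iff)

lemma LRm_comp: "LRm a b \<circ> LRm c d = LRm (a \<odot> c) (d \<odot> b)"
  by (simp add: LRm_def fun_eq_iff qmult_assoc)

lemma LRm_scaleR: "LRm (r *\<^sub>R a) b = (\<lambda>x. r *\<^sub>R LRm a b x)" "LRm a (r *\<^sub>R b) = (\<lambda>x. r *\<^sub>R LRm a b x)"
  by (simp_all add: LRm_def)

lemma linear_LRm: "linear (LRm a b)"
  by (rule linearI) (simp_all add: LRm_def qmult_add)

lemma LRm_inverse:
  assumes "a \<noteq> 0" "b \<noteq> 0"
  shows "LRm a b \<circ> LRm (qinv a) (qinv b) = id" "LRm (qinv a) (qinv b) \<circ> LRm a b = id"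
  using assms by (simp_all add: LRm_comp)

lemma bij_LRm: "a \<noteq> 0 \<Longrightarrow> b \<noteq> 0 \<Longrightarrow> bij (LRm a b)"
  using LRm_inverse by (metis o_bij)

text \<open>
  The adjoint of multiplication by \<open>a\<close> is multiplication by its conjugate, which is a positive multiple
  of the inverse. So conjugation by a two-sided multiplication respects symmetric positive definite maps.
\<close>

lemma LRm_adjoint: "LRm a b x \<bullet> y = x \<bullet> LRm (qcnj a) (qcnj b) y"
  by (simp add: LRm_def inner_quat algebra_simps)

text \<open>
  If \<open>a x b = r c x d\<close> for all \<open>x\<close>, then \<open>c\<inverse> a\<close> commutes with every \<open>x\<close>, so it is central and hence real.
\<close>

lemma LRm_eq_scaleR_iff:
  assumes "a \<noteq> 0" "b \<noteq> 0" "c \<noteq> 0" "d \<noteq> 0"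
  shows "(\<exists>r. r \<noteq> 0 \<and> LRm a b = (\<lambda>x. r *\<^sub>R LRm c d x)) \<longleftrightarrow> a \<sim> c \<and> b \<sim> d"
proof
  assume "\<exists>r. r \<noteq> 0 \<and> LRm a b = (\<lambda>x. r *\<^sub>R LRm c d x)"
  then obtain r where r: "r \<noteq> 0" and eq: "\<And>x. a \<odot> x \<odot> b = r *\<^sub>R (c \<odot> x \<odot> d)"
    unfolding LRm_def by metis
  let ?u = "qinv c \<odot> a" and ?v = "d \<odot> qinv b"
  have uv: "?u \<odot> x = r *\<^sub>R (x \<odot> ?v)" for x
  proof -
    have "?u \<odot> x = qinv c \<odot> (a \<odot> x \<odot> b) \<odot> qinv b"
      using assms by (simp add: qmult_assoc)
    also have "\<dots> = qinv c \<odot> (r *\<^sub>R (c \<odot> x \<odot> d)) \<odot> qinv b"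
      by (simp only: eq)
    also have "\<dots> = r *\<^sub>R (x \<odot> ?v)"
      using assms by (simp add: qmult_assoc)
    finally show ?thesis .
  qed
  have u: "?u = r *\<^sub>R ?v"
    using uv[of qone] by simp
  have "?u \<odot> x = x \<odot> ?u" for x
    using uv[of x] by (simp add: u)
  then have real: "?u = (?u$1) *\<^sub>R qone"
    by (rule qmult_central_imp_real)
  have nz: "?u $ 1 \<noteq> 0"
    using real assms by (metis qinv_eq_0_iff qmult_eq_0_iff scaleR_zero_left)
  have "?u \<sim> qone"
    by (subst real) (use nz in simp)
  then have "a \<sim> c"
    using proportional_mult_left[of c ?u qone] assms by simp
  moreover have "?v \<sim> qone"
    using \<open>?u \<sim> qone\<close> u r by simp
  then have "d \<sim> b"
    using proportional_mult_right[of b ?v qone] assms by (simp add: qmult_assoc)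
  ultimately show "a \<sim> c \<and> b \<sim> d"
    by (simp add: proportional_sym)
next
  assume "a \<sim> c \<and> b \<sim> d"
  then obtain r s where "r \<noteq> 0" "s \<noteq> 0" "a = r *\<^sub>R c" "b = s *\<^sub>R d"
    unfolding proportional_def by blast
  then show "\<exists>r. r \<noteq> 0 \<and> LRm a b = (\<lambda>x. r *\<^sub>R LRm c d x)"
    by (intro exI[of _ "r * s"]) (simp add: LRm_scaleR mult.commute)
qed

lemma det_4:
  "det (A::'a::comm_ring_1^4^4) =
    A$1$1 * (A$2$2 * (A$3$3 * A$4$4 - A$3$4 * A$4$3) - A$2$3 * (A$3$2 * A$4$4 - A$3$4 * A$4$2)
      + A$2$4 * (A$3$2 * A$4$3 - A$3$3 * A$4$2))
    - A$1$2 * (A$2$1 * (A$3$3 * A$4$4 - A$3$4 * A$4$3) - A$2$3 * (A$3$1 * A$4$4 - A$3$4 * A$4$1)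
      + A$2$4 * (A$3$1 * A$4$3 - A$3$3 * A$4$1))
    + A$1$3 * (A$2$1 * (A$3$2 * A$4$4 - A$3$4 * A$4$2) - A$2$2 * (A$3$1 * A$4$4 - A$3$4 * A$4$1)
      + A$2$4 * (A$3$1 * A$4$2 - A$3$2 * A$4$1))
    - A$1$4 * (A$2$1 * (A$3$2 * A$4$3 - A$3$3 * A$4$2) - A$2$2 * (A$3$1 * A$4$3 - A$3$3 * A$4$1)
      + A$2$3 * (A$3$1 * A$4$2 - A$3$2 * A$4$1))"
proof -
  have f1234: "finite {2::4, 3, 4}" "1 \<notin> {2::4, 3, 4}"
    by auto
  have f234: "finite {3::4, 4}" "2 \<notin> {3::4, 4}"
    by auto
  have f34: "finite {4::4}" "3 \<notin> {4::4}"
    by auto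
  show ?thesis
    unfolding det_def UNIV_4
    unfolding sum_over_permutations_insert[OF f1234]
    unfolding sum_over_permutations_insert[OF f234]
    unfolding sum_over_permutations_insert[OF f34]
    unfolding permutes_sing
    by (simp add: sign_swap_id permutation_swap_id permutation_compose sign_compose sign_id
        swap_id_eq algebra_simps)
qed

lemma axis_nth: "(axis k c :: 'a::zero^'n) $ i = (if i = k then c else 0)"
  by (auto simp: axis_def)

lemma det_matrix_Lm: "det (matrix (Lm a)) = (qnorm a)\<^sup>2"
  by (simp add: det_4 matrix_def axis_nth Lm_def qnorm_eq power2_eq_square algebra_simps)

lemma det_matrix_Rm: "det (matrix (Rm a)) = (qnorm a)\<^sup>2"
  by (simp add: det_4 matrix_def axis_nth Rm_def qnorm_eq power2_eq_square algebra_simps)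

lemma det_matrix_comp:
  "linear f \<Longrightarrow> linear g \<Longrightarrow> det (matrix (f \<circ> g)) = det (matrix (f :: quat \<Rightarrow> quat)) * det (matrix g)"
  for g :: "quat \<Rightarrow> quat"
  by (simp add: matrix_compose det_mul)

lemma det_matrix_LRm: "det (matrix (LRm a b)) = (qnorm a * qnorm b)\<^sup>2"
proof -
  have "LRm a b = Lm a \<circ> Rm b"
    by (simp add: Lm_eq_LRm Rm_eq_LRm LRm_comp)
  then show ?thesis
    by (simp add: det_matrix_comp Lm_eq_LRm Rm_eq_LRm linear_LRm)
      (simp add: Lm_eq_LRm[symmetric] Rm_eq_LRm[symmetric] det_matrix_Lm det_matrix_Rm
        power_mult_distrib)
qed

lemma det_matrix_qcnj: "det (matrix qcnj) = -1"
  by (simp add: det_4 matrix_def axis_nth)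

lemma linear_qcnj: "linear qcnj"
  by (rule linearI) (simp_all add: quat_eq_iff)

lemma id_neq_qcnj [simp]: "id \<noteq> qcnj" "qcnj \<noteq> id"
proof -
  have "qcnj (axis 2 1) \<noteq> id (axis 2 1)"
    by (simp add: quat_eq_iff axis_nth)
  then show "id \<noteq> qcnj" "qcnj \<noteq> id"
    by metis+
qed

section \<open>The proper similitudes and their classes\<close>

lemma pure_unit_square: "x $ 1 = 0 \<Longrightarrow> qnorm x = 1 \<Longrightarrow> x \<odot> x = - qone"
  by (simp add: quat_eq_iff qnorm_eq power2_eq_square)

text \<open>
  Conjugation by \<open>1 - u v\<close> carries one square root of \<open>-1\<close> to another. The element is nonzero
  because the inverse of \<open>u\<close> is \<open>-u\<close>.
\<close>

lemma intertwine_imaginary_units: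
  assumes u: "u \<odot> u = - qone" and v: "v \<odot> v = - qone" and ne: "u \<noteq> - v"
  shows "qone - u \<odot> v \<noteq> 0" "(qone - u \<odot> v) \<odot> v = u \<odot> (qone - u \<odot> v)"
proof -
  have uuv: "u \<odot> (u \<odot> v) = - v"
    by (simp add: qmult_assoc[symmetric] u)
  then show "qone - u \<odot> v \<noteq> 0"
    using ne by auto
  show "(qone - u \<odot> v) \<odot> v = u \<odot> (qone - u \<odot> v)"
    by (simp add: qmult_diff qmult_assoc v uuv add.commute)
qed

definition proper_isometry :: "(quat \<Rightarrow> quat) \<Rightarrow> bool" where
  "proper_isometry f \<longleftrightarrow> linear f \<and> (\<forall>x. qnorm (f x) = qnorm x) \<and> det (matrix f) = 1"

lemma proper_isometry_inner:
  assumes "proper_isometry f"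
  shows "f x \<bullet> f y = x \<bullet> y"
proof -
  have "f (x + y) \<bullet> f (x + y) = (x + y) \<bullet> (x + y)" "f x \<bullet> f x = x \<bullet> x" "f y \<bullet> f y = y \<bullet> y"
    using assms by (simp_all add: proper_isometry_def flip: qnorm_inner)
  moreover have "f (x + y) = f x + f y"
    using assms by (simp add: proper_isometry_def linear_add)
  ultimately show ?thesis
    by (simp add: inner_add_left inner_add_right inner_commute)
qed

lemma proper_isometry_conj:
  assumes f: "proper_isometry f" and s: "s \<noteq> 0"
  shows "proper_isometry (LRm (qinv s) s \<circ> f)"
proof -
  have "qnorm (qinv s) * qnorm s = 1"
    using s qnorm_mult[of "qinv s" s] by simp
  then have "qnorm ((LRm (qinv s) s \<circ> f) x) = qnorm (f x)" for x
    by (simp add: LRm_def qnorm_mult)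
  moreover note \<open>qnorm (qinv s) * qnorm s = 1\<close>
  ultimately show ?thesis
    using f by (simp add: proper_isometry_def det_matrix_comp linear_LRm det_matrix_LRm
        linear_compose)
qed

lemma linear_quat_expand:
  assumes "linear f"
  shows "f (x::quat) = x$1 *\<^sub>R f (axis 1 1) + x$2 *\<^sub>R f (axis 2 1) + x$3 *\<^sub>R f (axis 3 1)
    + x$4 *\<^sub>R f (axis 4 1)"
proof -
  have "x = x$1 *\<^sub>R axis 1 1 + x$2 *\<^sub>R axis 2 1 + x$3 *\<^sub>R axis 3 1 + x$4 *\<^sub>R axis 4 1"
    by (simp add: quat_eq_iff axis_nth)
  then have "f x = f (x$1 *\<^sub>R axis 1 1 + x$2 *\<^sub>R axis 2 1 + x$3 *\<^sub>R axis 3 1 + x$4 *\<^sub>R axis 4 1)"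
    by (rule arg_cong)
  then show ?thesis
    by (simp add: linear_add[OF assms] linear_scale[OF assms])
qed

lemma qone_axis: "qone = axis 1 1"
  by (simp add: quat_eq_iff axis_nth)

lemma proper_isometry_nth:
  assumes "proper_isometry f" and "f (axis k 1) = axis k 1"
  shows "f x $ k = x $ k"
  using proper_isometry_inner[OF assms(1), of "axis k 1" x] assms(2) by (simp add: inner_axis')

text \<open>
  By orthogonality the image of \<open>k\<close> is a multiple of \<open>k\<close>, and the determinant is the multiplier.
\<close>

lemma proper_isometry_fix_ij:
  assumes f: "proper_isometry f"
    and fix1: "f (axis 1 1) = axis 1 1" and fix2: "f (axis 2 1) = axis 2 1"
    and fix3: "f (axis 3 1) = axis 3 1"
  shows "f = id"
proof -
  let ?k = "f (axis 4 1)"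
  have 0: "?k $ 1 = 0" "?k $ 2 = 0" "?k $ 3 = 0"
    using proper_isometry_nth[OF f] fix1 fix2 fix3 by (simp_all add: axis_nth)
  have lin: "linear f" and det: "det (matrix f) = 1"
    using f by (simp_all add: proper_isometry_def)
  have k: "?k $ 4 = 1"
    using det by (simp add: det_4 matrix_def fix1 fix2 fix3 axis_nth 0)
  have "?k = axis 4 1"
    using 0 k by (simp add: quat_eq_iff axis_nth)
  then have "f x = x" for x
    by (subst linear_quat_expand[OF lin]) (simp add: fix1 fix2 fix3 quat_eq_iff axis_nth)
  then show ?thesis
    by auto
qed

text \<open>
  The classical parametrization of rotations of the imaginary quaternions. A first conjugation moves
  the image of \<open>i\<close> back to \<open>i\<close>. A second one, by an element that commutes with \<open>i\<close>, moves the image of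
  \<open>j\<close> back to \<open>j\<close> without disturbing \<open>i\<close>; what remains is the identity.
\<close>

lemma proper_isometry_eq_conj:
  assumes f: "proper_isometry f" and f1: "f qone = qone"
  shows "\<exists>s. s \<noteq> 0 \<and> f = LRm s (qinv s)"
proof -
  let ?i = "axis 2 1 :: quat" and ?j = "axis 3 1 :: quat" and ?k = "axis 4 1 :: quat"
  have n: "qnorm (f x) = qnorm x" for x
    using f by (simp add: proper_isometry_def)
  have f1': "f (axis 1 1) = axis 1 1"
    using f1 by (simp add: qone_axis)
  have units: "?i \<odot> ?i = - qone" "?j \<odot> ?j = - qone"
    by (simp_all add: quat_eq_iff axis_nth)
  have fi: "f ?i \<odot> f ?i = - qone"
    by (rule pure_unit_square)
      (use proper_isometry_nth[OF f f1'] in \<open>simp_all add: n axis_nth, simp add: qnorm_eq axis_nth\<close>)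
  have "\<exists>s. s \<noteq> 0 \<and> s \<odot> ?i = f ?i \<odot> s"
  proof (cases "f ?i = - ?i")
    case True
    then show ?thesis
      by (intro exI[of _ ?j]) (simp add: quat_eq_iff axis_nth)
  next
    case False
    then show ?thesis
      using intertwine_imaginary_units[OF fi units(1)] by blast
  qed
  then obtain s where s: "s \<noteq> 0" "s \<odot> ?i = f ?i \<odot> s"
    by blast
  define g where "g = LRm (qinv s) s \<circ> f"
  have g: "proper_isometry g"
    unfolding g_def using f s(1) by (rule proper_isometry_conj)
  have g1: "g (axis 1 1) = axis 1 1"
    using s(1) by (simp add: g_def LRm_def f1 flip: qone_axis)
  have g2: "g ?i = ?i"
    using s by (simp add: g_def LRm_def qmult_assoc flip: s(2))
  have gj: "g ?j \<odot> g ?j = - qone"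
    by (rule pure_unit_square)
      (use g proper_isometry_nth[OF g g1] in \<open>simp_all add: proper_isometry_def axis_nth,
        simp add: qnorm_eq axis_nth\<close>)
  have gj2: "g ?j $ 1 = 0" "g ?j $ 2 = 0"
    using proper_isometry_nth[OF g g1] proper_isometry_nth[OF g g2] by (simp_all add: axis_nth)
  have "\<exists>t. t \<noteq> 0 \<and> t \<odot> ?i = ?i \<odot> t \<and> t \<odot> ?j = g ?j \<odot> t"
  proof (cases "g ?j = - ?j")
    case True
    then show ?thesis
      by (intro exI[of _ ?i]) (simp add: quat_eq_iff axis_nth)
  next
    case False
    \<comment> \<open>The image of \<open>j\<close> lies in the plane of \<open>j\<close> and \<open>k\<close>, so \<open>g j \<odot> j\<close> lies in that of \<open>1\<close> and \<open>i\<close>.\<close>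
    let ?t = "qone - g ?j \<odot> ?j"
    have "?t \<odot> ?i = ?i \<odot> ?t"
      using gj2 by (simp add: quat_eq_iff axis_nth)
    then show ?thesis
      using intertwine_imaginary_units[OF gj units(2) False] by blast
  qed
  then obtain t where t: "t \<noteq> 0" "t \<odot> ?i = ?i \<odot> t" "t \<odot> ?j = g ?j \<odot> t"
    by blast
  have "LRm (qinv t) t \<circ> g = id"
  proof (rule proper_isometry_fix_ij)
    show "proper_isometry (LRm (qinv t) t \<circ> g)"
      using g t(1) by (rule proper_isometry_conj)
    show "(LRm (qinv t) t \<circ> g) (axis 1 1) = axis 1 1"
      using g1 t(1) by (simp add: LRm_def flip: qone_axis)
    show "(LRm (qinv t) t \<circ> g) ?i = ?i"
      using t by (simp add: LRm_def g2 qmult_assoc flip: t(2))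
    show "(LRm (qinv t) t \<circ> g) ?j = ?j"
      using t by (simp add: LRm_def qmult_assoc flip: t(3))
  qed
  then have "LRm (qinv (s \<odot> t)) (s \<odot> t) \<circ> f = id"
    using s(1) t(1) by (simp add: g_def qinv_mult LRm_comp flip: comp_assoc)
  moreover have "LRm (s \<odot> t) (qinv (s \<odot> t)) \<circ> (LRm (qinv (s \<odot> t)) (s \<odot> t) \<circ> f) = f"
    using s(1) t(1) by (simp add: LRm_comp flip: comp_assoc)
  ultimately have "f = LRm (s \<odot> t) (qinv (s \<odot> t))"
    by simp
  then show ?thesis
    using s(1) t(1) by (intro exI[of _ "s \<odot> t"]) simp
qed

text \<open>
  Dividing a proper similitude by its value at \<open>1\<close> leaves a proper isometry that fixes \<open>1\<close>. The condition
  on the determinant is what excludes the improper similitudes \<open>x \<mapsto> a qcnj x b\<close>.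
\<close>

proposition carrier_GOp: "carrier GOp = {LRm a b | a b. a \<noteq> 0 \<and> b \<noteq> 0}"
proof (intro equalityI subsetI)
  fix f assume "f \<in> carrier GOp"
  then obtain m where lin: "linear f" and bij: "bij f"
    and n: "\<And>x. qnorm (f x) = m * qnorm x" and det: "det (matrix f) = m\<^sup>2"
    unfolding GOp_def by auto
  let ?c = "f qone"
  have m: "m = qnorm ?c"
    using n[of qone] by simp
  have c: "?c \<noteq> 0"
    using bij linear_0[OF lin] by (metis bij_pointE qone_neq_0)
  have nc: "qnorm (qinv ?c) * m = 1"
    unfolding m using c qnorm_mult[of "qinv ?c" "?c"] by simp
  let ?g = "LRm (qinv ?c) qone \<circ> f"
  have "proper_isometry ?g"
    unfolding proper_isometry_def
  proof (intro conjI allI)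
    show "linear ?g"
      using lin by (simp add: linear_compose linear_LRm)
    show "qnorm (?g x) = qnorm x" for x
      using nc by (simp add: LRm_def qnorm_mult n)
    show "det (matrix ?g) = 1"
      using nc by (simp add: det_matrix_comp lin linear_LRm det_matrix_LRm det
          flip: power_mult_distrib)
  qed
  moreover have "?g qone = qone"
    using c by (simp add: LRm_def)
  ultimately obtain s where s: "s \<noteq> 0" "?g = LRm s (qinv s)"
    using proper_isometry_eq_conj by blast
  have "f = LRm ?c qone \<circ> ?g"
    using c by (simp add: LRm_comp flip: comp_assoc)
  then have "f = LRm (?c \<odot> s) (qinv s)"
    by (simp add: s(2) LRm_comp)
  then show "f \<in> {LRm a b | a b. a \<noteq> 0 \<and> b \<noteq> 0}"
    using c s(1) by (metis (mono_tags, lifting) mem_Collect_eq qinv_eq_0_iff qmult_eq_0_iff)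
next
  fix f assume "f \<in> {LRm a b | a b. a \<noteq> 0 \<and> b \<noteq> 0}"
  then obtain a b where f: "f = LRm a b" and "a \<noteq> 0" "b \<noteq> 0"
    by blast
  moreover have "qnorm (f x) = (qnorm a * qnorm b) * qnorm x" for x
    by (simp add: f LRm_def qnorm_mult)
  ultimately show "f \<in> carrier GOp"
    unfolding GOp_def by (auto simp: linear_LRm bij_LRm det_matrix_LRm)
qed

lemma GOp_cases:
  assumes "f \<in> carrier GOp"
  obtains a b where "a \<noteq> 0" "b \<noteq> 0" "f = LRm a b"
  using assms unfolding carrier_GOp by blast

lemma LRm_in_GOp [simp]: "a \<noteq> 0 \<Longrightarrow> b \<noteq> 0 \<Longrightarrow> LRm a b \<in> carrier GOp"
  unfolding carrier_GOp by blast

lemma mult_GOp [simp]: "f \<otimes>\<^bsub>GOp\<^esub> g = f \<circ> g" and one_GOp [simp]: "\<one>\<^bsub>GOp\<^esub> = id"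
  by (simp_all add: GOp_def)

lemma group_GOp: "group GOp"
proof (rule groupI)
  fix f assume "f \<in> carrier GOp"
  then obtain a b where "a \<noteq> 0" "b \<noteq> 0" "f = LRm a b"
    by (rule GOp_cases)
  then show "\<exists>g \<in> carrier GOp. g \<otimes>\<^bsub>GOp\<^esub> f = \<one>\<^bsub>GOp\<^esub>"
    by (intro bexI[of _ "LRm (qinv a) (qinv b)"]) (simp_all add: LRm_inverse)
next
  show "\<one>\<^bsub>GOp\<^esub> \<in> carrier GOp"
    using LRm_in_GOp[of qone qone] by simp
qed (auto elim!: GOp_cases simp: LRm_comp comp_assoc)

lemma inv_GOp_LRm: "a \<noteq> 0 \<Longrightarrow> b \<noteq> 0 \<Longrightarrow> inv\<^bsub>GOp\<^esub> LRm a b = LRm (qinv a) (qinv b)"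
  by (rule group.inv_equality[OF group_GOp]) (simp_all add: LRm_inverse)

lemma homotheties_eq: "homotheties = {LRm (r *\<^sub>R qone) qone | r. r \<noteq> 0}"
  by (simp add: homotheties_def LRm_def)

lemma normal_homotheties: "homotheties \<lhd> GOp"
proof -
  interpret group GOp by (rule group_GOp)
  have mem: "r \<noteq> 0 \<Longrightarrow> LRm (r *\<^sub>R qone) qone \<in> homotheties" for r
    unfolding homotheties_eq by blast
  have cases: "\<exists>r. r \<noteq> 0 \<and> f = LRm (r *\<^sub>R qone) qone" if "f \<in> homotheties" for f
    using that unfolding homotheties_eq by blast
  have "subgroup homotheties GOp"
  proof (rule subgroupI)
    show "homotheties \<noteq> {}"
      using mem[of 1] by auto
    show "homotheties \<subseteq> carrier GOp"
      by (auto dest: cases)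
    show "inv\<^bsub>GOp\<^esub> f \<in> homotheties" if "f \<in> homotheties" for f
      using cases[OF that] by (auto simp: inv_GOp_LRm qinv_scaleR mem)
    show "f \<otimes>\<^bsub>GOp\<^esub> g \<in> homotheties" if "f \<in> homotheties" "g \<in> homotheties" for f g
      using cases[OF that(1)] cases[OF that(2)] mem by (fastforce simp: LRm_comp)
  qed
  moreover have "f \<otimes>\<^bsub>GOp\<^esub> h \<otimes>\<^bsub>GOp\<^esub> inv\<^bsub>GOp\<^esub> f \<in> homotheties"
    if "f \<in> carrier GOp" "h \<in> homotheties" for f h
    using cases[OF that(2)] that(1) mem
    by (auto elim!: GOp_cases simp: inv_GOp_LRm LRm_comp)
  ultimately show ?thesis
    by (simp add: normal_inv_iff)
qed

lemma cls_eq: "cls f = {(\<lambda>x. r *\<^sub>R f x) | r. r \<noteq> 0}"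
  by (auto simp: cls_def r_coset_def homotheties_def comp_def)

lemma cls_eq_iff: "cls f = cls g \<longleftrightarrow> (\<exists>r. r \<noteq> 0 \<and> f = (\<lambda>x. r *\<^sub>R g x))"
proof
  assume "cls f = cls g"
  moreover have "f \<in> cls f"
    unfolding cls_eq by (auto intro: exI[of _ 1])
  ultimately show "\<exists>r. r \<noteq> 0 \<and> f = (\<lambda>x. r *\<^sub>R g x)"
    unfolding cls_eq by blast
next
  assume "\<exists>r. r \<noteq> 0 \<and> f = (\<lambda>x. r *\<^sub>R g x)"
  then obtain r where r: "r \<noteq> 0" "f = (\<lambda>x. r *\<^sub>R g x)"
    by blast
  have "\<exists>s'. s' \<noteq> 0 \<and> (\<lambda>x. s *\<^sub>R f x) = (\<lambda>x. s' *\<^sub>R g x)" if "s \<noteq> 0" for s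
    using that r by (intro exI[of _ "s * r"]) simp
  moreover have "\<exists>s'. s' \<noteq> 0 \<and> (\<lambda>x. s *\<^sub>R g x) = (\<lambda>x. s' *\<^sub>R f x)" if "s \<noteq> 0" for s
    using that r by (intro exI[of _ "s / r"]) simp
  ultimately show "cls f = cls g"
    unfolding cls_eq by blast
qed

lemma cls_LRm_eq_iff:
  assumes "a \<noteq> 0" "b \<noteq> 0" "c \<noteq> 0" "d \<noteq> 0"
  shows "cls (LRm a b) = cls (LRm c d) \<longleftrightarrow> a \<sim> c \<and> b \<sim> d"
  unfolding cls_eq_iff LRm_eq_scaleR_iff[OF assms] ..

lemma carrier_PGOp: "carrier PGOp = {cls (LRm a b) | a b. a \<noteq> 0 \<and> b \<noteq> 0}"
  unfolding PGOp_def carrier_FactGroup carrier_GOp by (auto simp: cls_def)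

lemma PGOp_cases:
  assumes "g \<in> carrier PGOp"
  obtains a b where "a \<noteq> 0" "b \<noteq> 0" "g = cls (LRm a b)"
  using assms unfolding carrier_PGOp by blast

lemma cls_in_PGOp [simp]: "a \<noteq> 0 \<Longrightarrow> b \<noteq> 0 \<Longrightarrow> cls (LRm a b) \<in> carrier PGOp"
  unfolding carrier_PGOp by blast

lemma group_PGOp: "group PGOp"
  unfolding PGOp_def by (rule normal.factorgroup_is_group[OF normal_homotheties])

lemma mult_PGOp:
  assumes "a \<noteq> 0" "b \<noteq> 0" "c \<noteq> 0" "d \<noteq> 0"
  shows "cls (LRm a b) \<otimes>\<^bsub>PGOp\<^esub> cls (LRm c d) = cls (LRm (a \<odot> c) (d \<odot> b))"
  unfolding PGOp_def cls_def mult_FactGroup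
  using normal.rcos_sum[OF normal_homotheties, of "LRm a b" "LRm c d"] assms
  by (simp add: LRm_comp)

lemma one_PGOp: "\<one>\<^bsub>PGOp\<^esub> = cls (LRm qone qone)"
  by (auto simp: PGOp_def cls_def r_coset_def)

lemma inv_PGOp:
  assumes "a \<noteq> 0" "b \<noteq> 0"
  shows "inv\<^bsub>PGOp\<^esub> cls (LRm a b) = cls (LRm (qinv a) (qinv b))"
  by (rule group.inv_equality[OF group_PGOp]) (use assms in \<open>simp_all add: mult_PGOp one_PGOp\<close>)

definition hcls :: "quat \<Rightarrow> quat set" where
  "hcls a = Rstar #>\<^bsub>Hstar\<^esub> a"

lemma hcls_eq: "hcls a = {r *\<^sub>R a | r. r \<noteq> 0}"
  by (auto simp: hcls_def r_coset_def Hstar_def Rstar_def)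

lemma hcls_eq_iff: "hcls a = hcls b \<longleftrightarrow> a \<sim> b"
proof
  assume "hcls a = hcls b"
  moreover have "a \<in> hcls a"
    unfolding hcls_eq by (auto intro: exI[of _ 1])
  ultimately show "a \<sim> b"
    unfolding hcls_eq proportional_def by blast
next
  have eq: "hcls a = {x. x \<sim> a}" for a
    by (auto simp: hcls_eq proportional_def)
  assume "a \<sim> b"
  then show "hcls a = hcls b"
    unfolding eq using proportional_trans proportional_sym by blast
qed

lemma carrier_Hstar [simp]: "carrier Hstar = {x. x \<noteq> 0}" and mult_Hstar [simp]: "x \<otimes>\<^bsub>Hstar\<^esub> y = x \<odot> y"
  and one_Hstar [simp]: "\<one>\<^bsub>Hstar\<^esub> = qone"
  by (simp_all add: Hstar_def)

lemma group_Hstar: "group Hstar"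
proof (rule groupI)
  fix x assume "x \<in> carrier Hstar"
  then show "\<exists>y \<in> carrier Hstar. y \<otimes>\<^bsub>Hstar\<^esub> x = \<one>\<^bsub>Hstar\<^esub>"
    by (intro bexI[of _ "qinv x"]) auto
qed (auto simp: qmult_assoc)

lemma inv_Hstar: "a \<noteq> 0 \<Longrightarrow> inv\<^bsub>Hstar\<^esub> a = qinv a"
  by (rule group.inv_equality[OF group_Hstar]) simp_all

lemma normal_Rstar: "Rstar \<lhd> Hstar"
proof -
  interpret group Hstar by (rule group_Hstar)
  have "subgroup Rstar Hstar"
  proof (rule subgroupI)
    show "Rstar \<noteq> {}" "Rstar \<subseteq> carrier Hstar"
      by (auto simp: Rstar_def intro: exI[of _ 1])
    show "inv\<^bsub>Hstar\<^esub> a \<in> Rstar" if "a \<in> Rstar" for a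
      using that by (auto simp: Rstar_def inv_Hstar qinv_scaleR intro: exI[of _ "inverse _"])
    show "a \<otimes>\<^bsub>Hstar\<^esub> b \<in> Rstar" if "a \<in> Rstar" "b \<in> Rstar" for a b
      using that by (fastforce simp: Rstar_def)
  qed
  moreover have "x \<otimes>\<^bsub>Hstar\<^esub> h \<otimes>\<^bsub>Hstar\<^esub> inv\<^bsub>Hstar\<^esub> x \<in> Rstar"
    if "x \<in> carrier Hstar" "h \<in> Rstar" for x h
    using that by (simp add: Rstar_def) (auto simp: inv_Hstar)
  ultimately show ?thesis
    by (simp add: normal_inv_iff)
qed

lemma group_PHstar: "group PHstar"
  unfolding PHstar_def by (rule normal.factorgroup_is_group[OF normal_Rstar])

lemma carrier_PHstar: "carrier PHstar = {hcls a | a. a \<noteq> 0}"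
  unfolding PHstar_def carrier_FactGroup by (auto simp: hcls_def)

lemma PHstar_cases:
  assumes "s \<in> carrier PHstar"
  obtains a where "a \<noteq> 0" "s = hcls a"
  using assms unfolding carrier_PHstar by blast

lemma hcls_in_PHstar [simp]: "a \<noteq> 0 \<Longrightarrow> hcls a \<in> carrier PHstar"
  unfolding carrier_PHstar by blast

lemma mult_PHstar: "a \<noteq> 0 \<Longrightarrow> b \<noteq> 0 \<Longrightarrow> hcls a \<otimes>\<^bsub>PHstar\<^esub> hcls b = hcls (a \<odot> b)"
  unfolding PHstar_def hcls_def mult_FactGroup
  using normal.rcos_sum[OF normal_Rstar, of a b] by simp

lemma one_PHstar: "\<one>\<^bsub>PHstar\<^esub> = hcls qone"
  by (auto simp: PHstar_def hcls_def r_coset_def)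

lemma inv_PHstar: "a \<noteq> 0 \<Longrightarrow> inv\<^bsub>PHstar\<^esub> hcls a = hcls (qinv a)"
  by (rule group.inv_equality[OF group_PHstar]) (simp_all add: mult_PHstar one_PHstar)

section \<open>Triality, orbits and the action\<close>

lemma twist_id [simp]: "twist id f = f"
  by (simp add: twist_def)

lemma twist_qcnj_LRm: "twist qcnj (LRm p q) = LRm (qcnj q) (qcnj p)"
  by (simp add: twist_def LRm_def fun_eq_iff qcnj_mult qmult_assoc)

lemma twist_LRm_cases:
  assumes "l \<in> C2" "p \<noteq> 0" "q \<noteq> 0"
  obtains p' q' where "p' \<noteq> 0" "q' \<noteq> 0" "twist l (LRm p q) = LRm p' q'"
  using assms that[of p q] that[of "qcnj q" "qcnj p"] by (auto simp: C2_def twist_qcnj_LRm)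

lemma twist_comp:
  assumes "l \<in> C2"
  shows "twist l (f \<circ> g) = twist l f \<circ> twist l g"
  using assms by (auto simp: C2_def twist_def fun_eq_iff)

lemma twist_scaleR:
  assumes "l \<in> C2"
  shows "twist l (\<lambda>x. r *\<^sub>R f x) = (\<lambda>x. r *\<^sub>R twist l f x)"
  using assms by (auto simp: C2_def twist_def fun_eq_iff linear_scale[OF linear_qcnj])

text \<open>
  Twisting replaces the factors by multiples of themselves, because the conjugate of \<open>s\<close> is a multiple
  of \<open>s\<inverse>\<close>, and the two real factors cancel.
\<close>

lemma twist_conj:
  assumes "l \<in> C2" "s \<noteq> 0"
  shows "twist l (LRm s (qinv s)) = LRm s (qinv s)"
proof -
  have "LRm (qcnj (qinv s)) (qcnj s) = LRm s (qinv s)"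
    by (simp add: qinv_def qcnj_scaleR LRm_scaleR)
  then show ?thesis
    using assms by (auto simp: C2_def twist_qcnj_LRm)
qed

lemma conj_by_LRm:
  "p \<noteq> 0 \<Longrightarrow> q \<noteq> 0 \<Longrightarrow> conj_by (LRm p q) \<delta> = LRm p q \<circ> \<delta> \<circ> LRm (qinv p) (qinv q)"
  by (simp add: conj_by_def inv_GOp_LRm)

lemma conj_by_LRm_comp:
  assumes "p \<noteq> 0" "q \<noteq> 0" "p' \<noteq> 0" "q' \<noteq> 0"
  shows "conj_by (LRm p q) (conj_by (LRm p' q') \<delta>) = conj_by (LRm (p \<odot> p') (q' \<odot> q)) \<delta>"
proof -
  have "conj_by (LRm p q) (conj_by (LRm p' q') \<delta>)
      = (LRm p q \<circ> LRm p' q') \<circ> \<delta> \<circ> (LRm (qinv p') (qinv q') \<circ> LRm (qinv p) (qinv q))"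
    using assms by (simp add: conj_by_LRm comp_assoc)
  then show ?thesis
    using assms by (simp add: LRm_comp conj_by_LRm qinv_mult)
qed

lemma conj_by_id [simp]: "conj_by id \<delta> = \<delta>"
  using conj_by_LRm[of qone qone \<delta>] by simp

lemma conj_by_cong:
  assumes "cls (LRm p q) = cls (LRm p' q')" "p \<noteq> 0" "q \<noteq> 0" "p' \<noteq> 0" "q' \<noteq> 0" and \<delta>: "linear \<delta>"
  shows "conj_by (LRm p q) \<delta> = conj_by (LRm p' q') \<delta>"
proof -
  have "p \<sim> p'" "q \<sim> q'"
    using assms by (simp_all add: cls_LRm_eq_iff)
  then obtain r s where "r \<noteq> 0" "s \<noteq> 0" "p = r *\<^sub>R p'" "q = s *\<^sub>R q'"
    unfolding proportional_def by blast
  moreover define k where "k = r * s"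
  ultimately have k: "k \<noteq> 0" and eq: "LRm p q = (\<lambda>x. k *\<^sub>R LRm p' q' x)"
    "LRm (qinv p) (qinv q) = (\<lambda>x. inverse k *\<^sub>R LRm (qinv p') (qinv q') x)"
    using assms by (simp_all add: qinv_scaleR LRm_scaleR mult.commute)
  show ?thesis
    unfolding conj_by_LRm[OF assms(2,3)] conj_by_LRm[OF assms(4,5)]
    unfolding eq using k by (simp add: fun_eq_iff linear_scale[OF \<delta>] linear_scale[OF linear_LRm])
qed

lemma conj_by_SPds:
  assumes \<delta>: "\<delta> \<in> SPds" and p: "p \<noteq> 0" and q: "q \<noteq> 0"
  shows "conj_by (LRm p q) \<delta> \<in> SPds"
proof -
  let ?f = "LRm p q" and ?g = "LRm (qinv p) (qinv q)"
  let ?N = "qnorm p * qnorm q"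
  have lin: "linear \<delta>" and sym: "\<And>x y. \<delta> x \<bullet> y = x \<bullet> \<delta> y"
    and pos: "\<And>x. x \<noteq> 0 \<Longrightarrow> \<delta> x \<bullet> x > 0" and det: "det (matrix \<delta>) = 1"
    using \<delta> by (auto simp: SPds_def)
  have N: "?N > 0"
    using p q by simp
  have adj1: "?f x \<bullet> y = ?N * (x \<bullet> ?g y)" for x y
    using p q by (simp add: LRm_adjoint qcnj_eq_qinv LRm_scaleR)
  have adj2: "x \<bullet> ?f y = ?N * (?g x \<bullet> y)" for x y
    using adj1[of y x] by (simp add: inner_commute)
  have eq: "conj_by ?f \<delta> = ?f \<circ> \<delta> \<circ> ?g"
    using p q by (rule conj_by_LRm)
  have "linear (conj_by ?f \<delta>)"
    unfolding eq by (intro linear_compose linear_LRm lin)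
  moreover have "conj_by ?f \<delta> x \<bullet> y = x \<bullet> conj_by ?f \<delta> y" for x y
    unfolding eq by (simp add: adj1 adj2 sym)
  moreover have "conj_by ?f \<delta> x \<bullet> x > 0" if "x \<noteq> 0" for x
  proof -
    have "?g x \<noteq> 0"
      using that p q by (simp add: LRm_def)
    then show ?thesis
      unfolding eq using N by (simp add: adj1 pos)
  qed
  moreover have "det (matrix (conj_by ?f \<delta>)) = 1"
  proof -
    have "det (matrix ?f) * det (matrix ?g) = det (matrix (?f \<circ> ?g))"
      by (simp add: det_matrix_comp linear_LRm)
    also have "\<dots> = 1"
      unfolding LRm_inverse(1)[OF p q] by (simp add: matrix_id_mat_1)
    finally show ?thesis
      unfolding eq by (simp add: det_matrix_comp linear_LRm lin linear_compose det)
  qed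
  ultimately show ?thesis
    by (simp add: SPds_def)
qed

lemma triality_LRm: "p \<noteq> 0 \<Longrightarrow> q \<noteq> 0 \<Longrightarrow> triality (LRm p q) (LRm p qone) (LRm qone q)"
  by (simp add: triality_def) (simp add: LRm_def qmult_assoc)

text \<open>
  Putting \<open>y = 1\<close> and \<open>x = 1\<close> in the triality relation gives two equations between two-sided
  multiplications. They determine the outer factors, and they show that the inner ones cancel.
\<close>

lemma triality_LRm_imp:
  assumes tri: "triality (LRm p q) (LRm a b) (LRm c d)"
    and nz: "p \<noteq> 0" "q \<noteq> 0" "a \<noteq> 0" "b \<noteq> 0" "c \<noteq> 0" "d \<noteq> 0"
  shows "a \<sim> p" "d \<sim> q" "b \<odot> c \<sim> qone"
proof -
  have eq: "p \<odot> (x \<odot> y) \<odot> q = a \<odot> x \<odot> b \<odot> (c \<odot> y \<odot> d)" for x y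
    using tri by (simp add: triality_def LRm_def)
  have "LRm a (b \<odot> c \<odot> d) = LRm p q"
    using eq[of _ qone] by (simp add: LRm_def fun_eq_iff qmult_assoc)
  then have 1: "a \<sim> p" "b \<odot> c \<odot> d \<sim> q"
    using nz cls_LRm_eq_iff[of a "b \<odot> c \<odot> d" p q] by simp_all
  have "LRm (a \<odot> b \<odot> c) d = LRm p q"
    using eq[of qone] by (simp add: LRm_def fun_eq_iff qmult_assoc)
  then have 2: "d \<sim> q"
    using nz cls_LRm_eq_iff[of "a \<odot> b \<odot> c" d p q] by simp_all
  show "a \<sim> p" "d \<sim> q" by fact+
  have "b \<odot> c \<odot> d \<sim> qone \<odot> d"
    using proportional_trans[OF 1(2) proportional_sym[OF 2]] by simp
  then show "b \<odot> c \<sim> qone"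
    using proportional_mult_right[OF nz(6)] by blast
qed

text \<open>
  For nonzero quaternions these sets are exactly the orbits of the quaternion units on pairs of classes
  (\<open>orb_LRm\<close>, \<open>orbits_eq\<close>), now in a form that shows the coordinates \<open>a, m, b\<close>.
\<close>

definition triple_orbit :: "quat \<Rightarrow> quat \<Rightarrow> quat \<Rightarrow> (pgo \<times> pgo) set" where
  "triple_orbit a m b = {(cls (LRm a' c), cls (LRm d b')) | a' b' c d.
     a' \<sim> a \<and> b' \<sim> b \<and> c \<odot> d \<sim> m}"

lemma triple_orbit_cases:
  assumes "(\<zeta>, \<eta>) \<in> triple_orbit a m b"
  obtains a' b' c d where "\<zeta> = cls (LRm a' c)" "\<eta> = cls (LRm d b')" "a' \<sim> a" "b' \<sim> b" "c \<odot> d \<sim> m"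
proof -
  have "\<exists>a' b' c d. \<zeta> = cls (LRm a' c) \<and> \<eta> = cls (LRm d b') \<and> a' \<sim> a \<and> b' \<sim> b \<and> c \<odot> d \<sim> m"
    using assms by (simp add: triple_orbit_def)
  then show thesis
    using that by blast
qed

lemma Hstar_act_LRm:
  assumes "w \<noteq> 0" "a \<noteq> 0" "b \<noteq> 0" "c \<noteq> 0" "d \<noteq> 0"
  shows "Hstar_act w (cls (LRm a c), cls (LRm d b))
    = (cls (LRm a (c \<odot> qinv w)), cls (LRm (w \<odot> d) b))"
  using assms by (simp add: Hstar_act_def Lm_eq_LRm Rm_eq_LRm inv_PGOp mult_PGOp)

text \<open>
  The element \<open>w\<close> cancels in \<open>(c w\<inverse>) (w d)\<close>. Conversely, if \<open>c' d' = c d\<close> up to a scalar, then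
  \<open>w = d' d\<inverse>\<close> carries \<open>(c, d)\<close> to \<open>(c', d')\<close> up to scalars.
\<close>

lemma orb_LRm:
  assumes nz: "a \<noteq> 0" "b \<noteq> 0" "c \<noteq> 0" "d \<noteq> 0"
  shows "orb (cls (LRm a c)) (cls (LRm d b)) = triple_orbit a (c \<odot> d) b"
proof -
  have orb: "orb (cls (LRm a c)) (cls (LRm d b))
      = {(cls (LRm a (c \<odot> qinv w)), cls (LRm (w \<odot> d) b)) | w. w \<noteq> 0}"
    unfolding orb_def orbit_def
    by (intro Collect_cong ex_cong1) (use nz in \<open>auto simp: Hstar_act_LRm\<close>)
  show ?thesis
  proof (intro equalityI subsetI)
    fix z assume "z \<in> orb (cls (LRm a c)) (cls (LRm d b))"
    then obtain w where w: "w \<noteq> 0" "z = (cls (LRm a (c \<odot> qinv w)), cls (LRm (w \<odot> d) b))"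
      unfolding orb by blast
    moreover have "c \<odot> qinv w \<odot> (w \<odot> d) = c \<odot> d"
      using w(1) by (simp add: qmult_assoc)
    ultimately show "z \<in> triple_orbit a (c \<odot> d) b"
      unfolding triple_orbit_def by (metis (mono_tags, lifting) mem_Collect_eq proportional_refl)
  next
    fix z assume "z \<in> triple_orbit a (c \<odot> d) b"
    then obtain a' b' c' d' where z: "z = (cls (LRm a' c'), cls (LRm d' b'))"
      and a': "a' \<sim> a" and b': "b' \<sim> b" and cd: "c' \<odot> d' \<sim> c \<odot> d"
      unfolding triple_orbit_def by blast
    have nz': "a' \<noteq> 0" "b' \<noteq> 0" "c' \<noteq> 0" "d' \<noteq> 0"
      using a' b' cd nz proportional_neq_0 by (metis qmult_eq_0_iff)+
    let ?w = "d' \<odot> qinv d"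
    have w: "?w \<noteq> 0" "?w \<odot> d = d'"
      using nz nz' by (simp_all add: qmult_assoc)
    have "c' \<odot> d' \<odot> qinv d' \<sim> c \<odot> d \<odot> qinv d'"
      by (rule proportional_mult[OF cd proportional_refl])
    then have "c' \<sim> c \<odot> qinv ?w"
      using nz nz' by (simp add: qmult_assoc qinv_mult)
    then have "z = (cls (LRm a (c \<odot> qinv ?w)), cls (LRm (?w \<odot> d) b))"
      unfolding w(2) z using a' b' nz nz' by (simp add: cls_LRm_eq_iff)
    then show "z \<in> orb (cls (LRm a c)) (cls (LRm d b))"
      unfolding orb using w(1) by blast
  qed
qed

lemma triple_orbit_eq_iff:
  assumes nz: "a \<noteq> 0" "m \<noteq> 0" "b \<noteq> 0" "a' \<noteq> 0" "m' \<noteq> 0" "b' \<noteq> 0"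
  shows "triple_orbit a m b = triple_orbit a' m' b' \<longleftrightarrow> a \<sim> a' \<and> m \<sim> m' \<and> b \<sim> b'"
proof
  assume eq: "triple_orbit a m b = triple_orbit a' m' b'"
  have "m \<odot> qone \<sim> m"
    by simp
  then have "(cls (LRm a m), cls (LRm qone b)) \<in> triple_orbit a m b"
    unfolding triple_orbit_def using proportional_refl by blast
  then obtain a1 b1 c d where mem: "cls (LRm a m) = cls (LRm a1 c)" "cls (LRm qone b) = cls (LRm d b1)"
    and 1: "a1 \<sim> a'" "b1 \<sim> b'" "c \<odot> d \<sim> m'"
    unfolding eq by (rule triple_orbit_cases)
  have "a1 \<noteq> 0" "b1 \<noteq> 0" "c \<noteq> 0" "d \<noteq> 0"
    using 1 nz proportional_neq_0 by (metis qmult_eq_0_iff)+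
  with mem nz have 2: "a \<sim> a1" "m \<sim> c" "qone \<sim> d" "b \<sim> b1"
    by (simp_all add: cls_LRm_eq_iff)
  have "m \<odot> qone \<sim> c \<odot> d"
    by (rule proportional_mult[OF 2(2,3)])
  then show "a \<sim> a' \<and> m \<sim> m' \<and> b \<sim> b'"
    using proportional_trans[OF 2(1) 1(1)] proportional_trans[OF 2(4) 1(2)]
      proportional_trans[of m "c \<odot> d" m'] 1(3) by simp
next
  assume "a \<sim> a' \<and> m \<sim> m' \<and> b \<sim> b'"
  then have "x \<sim> a \<longleftrightarrow> x \<sim> a'" "x \<sim> m \<longleftrightarrow> x \<sim> m'" "x \<sim> b \<longleftrightarrow> x \<sim> b'" for x
    using proportional_trans proportional_sym by blast+
  then show "triple_orbit a m b = triple_orbit a' m' b'"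
    by (simp add: triple_orbit_def)
qed

lemma orbits_eq:
  "orbits Hstar (carrier PGOp \<times> carrier PGOp) Hstar_act
    = {triple_orbit a m b | a m b. a \<noteq> 0 \<and> m \<noteq> 0 \<and> b \<noteq> 0}"
proof (intro equalityI subsetI)
  fix P assume "P \<in> orbits Hstar (carrier PGOp \<times> carrier PGOp) Hstar_act"
  then obtain \<zeta> \<eta> where P: "P = orb \<zeta> \<eta>" and "\<zeta> \<in> carrier PGOp" "\<eta> \<in> carrier PGOp"
    unfolding orbits_def orb_def by blast
  then obtain a b c d where nz: "a \<noteq> 0" "b \<noteq> 0" "c \<noteq> 0" "d \<noteq> 0"
    and "\<zeta> = cls (LRm a c)" "\<eta> = cls (LRm d b)"
    by (elim PGOp_cases) blast
  then have "P = triple_orbit a (c \<odot> d) b" "c \<odot> d \<noteq> 0"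
    using P by (simp_all add: orb_LRm)
  then show "P \<in> {triple_orbit a m b | a m b. a \<noteq> 0 \<and> m \<noteq> 0 \<and> b \<noteq> 0}"
    using nz by blast
next
  fix P assume "P \<in> {triple_orbit a m b | a m b. a \<noteq> 0 \<and> m \<noteq> 0 \<and> b \<noteq> 0}"
  then obtain a m b where "a \<noteq> 0" "m \<noteq> 0" "b \<noteq> 0" "P = triple_orbit a m b"
    by blast
  then have "P = orb (cls (LRm a m)) (cls (LRm qone b))" "cls (LRm a m) \<in> carrier PGOp"
      "cls (LRm qone b) \<in> carrier PGOp"
    by (simp_all add: orb_LRm)
  then show "P \<in> orbits Hstar (carrier PGOp \<times> carrier PGOp) Hstar_act"
    unfolding orbits_def orb_def by blast
qed

lemma Y_objects_eq: "Y_objects = {(triple_orbit a m b, (\<delta>, \<epsilon>), (l, n)) | a m b \<delta> \<epsilon> l n.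
    a \<noteq> 0 \<and> m \<noteq> 0 \<and> b \<noteq> 0 \<and> \<delta> \<in> SPds \<and> \<epsilon> \<in> SPds \<and> l \<in> C2 \<and> n \<in> C2}"
  unfolding Y_objects_def orbits_eq by blast

lemma SPds_linear: "\<delta> \<in> SPds \<Longrightarrow> linear \<delta>"
  by (simp add: SPds_def)

text \<open>
  The action in coordinates. Another representative of the acting class, other triality components and
  another representative of the orbit change each of the three entries by real scalars only: the
  inner factors of the triality components and of the pair meet in the middle entry and cancel there.
  So the set that defines the action is a singleton.
\<close>

lemma Y_act_triple_orbit:
  assumes nz: "p \<noteq> 0" "q \<noteq> 0" "a \<noteq> 0" "m \<noteq> 0" "b \<noteq> 0"
    and l: "l \<in> C2" "p1 \<noteq> 0" "q1 \<noteq> 0" "twist l (LRm p q) = LRm p1 q1"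
    and n: "n \<in> C2" "p2 \<noteq> 0" "q2 \<noteq> 0" "twist n (LRm p q) = LRm p2 q2"
    and \<delta>: "\<delta> \<in> SPds" and \<epsilon>: "\<epsilon> \<in> SPds"
  shows "Y_act (cls (LRm p q)) (triple_orbit a m b, (\<delta>, \<epsilon>), (l, n)) =
    (triple_orbit (p \<odot> a \<odot> qinv p1) (qinv q1 \<odot> m \<odot> qinv p2) (qinv q2 \<odot> b \<odot> q),
     (conj_by (LRm p1 q1) \<delta>, conj_by (LRm p2 q2) \<epsilon>), (l, n))" (is "_ = ?y")
proof -
  define S where "S = {(orb (cls \<phi>1 \<otimes>\<^bsub>PGOp\<^esub> \<zeta> \<otimes>\<^bsub>PGOp\<^esub> inv\<^bsub>PGOp\<^esub> (cls (twist l \<phi>)))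
           (cls \<phi>2 \<otimes>\<^bsub>PGOp\<^esub> \<eta> \<otimes>\<^bsub>PGOp\<^esub> inv\<^bsub>PGOp\<^esub> (cls (twist n \<phi>))),
       (conj_by (twist l \<phi>) \<delta>, conj_by (twist n \<phi>) \<epsilon>),
       (l, n))
      | \<phi> \<phi>1 \<phi>2 \<zeta> \<eta>. \<phi> \<in> cls (LRm p q) \<and> triality \<phi> \<phi>1 \<phi>2 \<and> (\<zeta>, \<eta>) \<in> triple_orbit a m b}"
  have "y = ?y" if yS: "y \<in> S" for y
  proof -
    obtain \<phi> \<phi>1 \<phi>2 \<zeta> \<eta> where y: "y = (orb (cls \<phi>1 \<otimes>\<^bsub>PGOp\<^esub> \<zeta> \<otimes>\<^bsub>PGOp\<^esub> inv\<^bsub>PGOp\<^esub> (cls (twist l \<phi>)))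
           (cls \<phi>2 \<otimes>\<^bsub>PGOp\<^esub> \<eta> \<otimes>\<^bsub>PGOp\<^esub> inv\<^bsub>PGOp\<^esub> (cls (twist n \<phi>))),
       (conj_by (twist l \<phi>) \<delta>, conj_by (twist n \<phi>) \<epsilon>), (l, n))"
      and \<phi>: "\<phi> \<in> cls (LRm p q)" and tri: "triality \<phi> \<phi>1 \<phi>2"
      and mem: "(\<zeta>, \<eta>) \<in> triple_orbit a m b"
      using yS unfolding S_def by blast
    obtain r where r: "r \<noteq> 0" "\<phi> = LRm (r *\<^sub>R p) q"
      using \<phi> unfolding cls_eq LRm_scaleR by blast
    have tw: "twist l \<phi> = LRm (r *\<^sub>R p1) q1" "twist n \<phi> = LRm (r *\<^sub>R p2) q2"
      using l n by (simp_all add: r(2) LRm_scaleR twist_scaleR)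
    obtain \<alpha> \<beta> \<gamma> \<theta> where comp: "\<alpha> \<noteq> 0" "\<beta> \<noteq> 0" "\<gamma> \<noteq> 0" "\<theta> \<noteq> 0"
      "\<phi>1 = LRm \<alpha> \<beta>" "\<phi>2 = LRm \<gamma> \<theta>"
      using tri unfolding triality_def by (elim conjE GOp_cases) blast
    have "\<alpha> \<sim> r *\<^sub>R p" "\<theta> \<sim> q" and \<beta>\<gamma>: "\<beta> \<odot> \<gamma> \<sim> qone"
      using triality_LRm_imp[of "r *\<^sub>R p" q \<alpha> \<beta> \<gamma> \<theta>] tri comp r nz by simp_all
    then have \<alpha>: "\<alpha> \<sim> p" and \<theta>: "\<theta> \<sim> q"
      using r(1) by simp_all
    obtain a' b' c d where \<zeta>: "\<zeta> = cls (LRm a' c)" and \<eta>: "\<eta> = cls (LRm d b')"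
      and a': "a' \<sim> a" and b': "b' \<sim> b" and cd: "c \<odot> d \<sim> m"
      using mem by (rule triple_orbit_cases)
    have nz': "a' \<noteq> 0" "b' \<noteq> 0" "c \<noteq> 0" "d \<noteq> 0"
      using a' b' cd nz proportional_neq_0 by (metis qmult_eq_0_iff)+
    have "orb (cls \<phi>1 \<otimes>\<^bsub>PGOp\<^esub> \<zeta> \<otimes>\<^bsub>PGOp\<^esub> inv\<^bsub>PGOp\<^esub> (cls (twist l \<phi>)))
        (cls \<phi>2 \<otimes>\<^bsub>PGOp\<^esub> \<eta> \<otimes>\<^bsub>PGOp\<^esub> inv\<^bsub>PGOp\<^esub> (cls (twist n \<phi>)))
      = triple_orbit (\<alpha> \<odot> a' \<odot> qinv (r *\<^sub>R p1))
          (qinv q1 \<odot> (c \<odot> \<beta>) \<odot> (\<gamma> \<odot> d \<odot> qinv (r *\<^sub>R p2)))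
          (qinv q2 \<odot> (b' \<odot> \<theta>))"
      using comp nz' l n r(1) by (simp add: tw \<zeta> \<eta> inv_PGOp mult_PGOp orb_LRm)
    also have "\<dots> = triple_orbit (p \<odot> a \<odot> qinv p1) (qinv q1 \<odot> m \<odot> qinv p2) (qinv q2 \<odot> b \<odot> q)"
    proof -
      have 1: "\<alpha> \<odot> a' \<odot> qinv (r *\<^sub>R p1) \<sim> p \<odot> a \<odot> qinv p1"
        using l r(1) by (intro proportional_mult \<alpha> a' proportional_qinv) simp_all
      have "c \<odot> (\<beta> \<odot> \<gamma>) \<odot> d \<sim> c \<odot> qone \<odot> d"
        by (intro proportional_mult \<beta>\<gamma> proportional_refl)
      also have "c \<odot> qone \<odot> d \<sim> m"
        using cd by simp
      finally have "qinv q1 \<odot> (c \<odot> (\<beta> \<odot> \<gamma>) \<odot> d) \<odot> qinv (r *\<^sub>R p2) \<sim> qinv q1 \<odot> m \<odot> qinv p2"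
        using l n r(1) by (intro proportional_mult proportional_qinv) simp_all
      then have 2: "qinv q1 \<odot> (c \<odot> \<beta>) \<odot> (\<gamma> \<odot> d \<odot> qinv (r *\<^sub>R p2)) \<sim> qinv q1 \<odot> m \<odot> qinv p2"
        by (simp only: qmult_assoc)
      have "qinv q2 \<odot> b' \<odot> \<theta> \<sim> qinv q2 \<odot> b \<odot> q"
        by (intro proportional_mult \<theta> b' proportional_refl)
      then have 3: "qinv q2 \<odot> (b' \<odot> \<theta>) \<sim> qinv q2 \<odot> b \<odot> q"
        by (simp only: qmult_assoc)
      show ?thesis
        using 1 2 3 comp nz nz' l n r(1) by (simp add: triple_orbit_eq_iff)
    qed
    finally have "orb (cls \<phi>1 \<otimes>\<^bsub>PGOp\<^esub> \<zeta> \<otimes>\<^bsub>PGOp\<^esub> inv\<^bsub>PGOp\<^esub> (cls (twist l \<phi>)))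
        (cls \<phi>2 \<otimes>\<^bsub>PGOp\<^esub> \<eta> \<otimes>\<^bsub>PGOp\<^esub> inv\<^bsub>PGOp\<^esub> (cls (twist n \<phi>)))
      = triple_orbit (p \<odot> a \<odot> qinv p1) (qinv q1 \<odot> m \<odot> qinv p2) (qinv q2 \<odot> b \<odot> q)" .
    moreover have "conj_by (twist l \<phi>) \<delta> = conj_by (LRm p1 q1) \<delta>"
      unfolding tw using l r(1) \<delta> by (intro conj_by_cong) (simp_all add: cls_LRm_eq_iff SPds_linear)
    moreover have "conj_by (twist n \<phi>) \<epsilon> = conj_by (LRm p2 q2) \<epsilon>"
      unfolding tw using n r(1) \<epsilon> by (intro conj_by_cong) (simp_all add: cls_LRm_eq_iff SPds_linear)
    ultimately show ?thesis
      unfolding y by simp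
  qed
  moreover have "S \<noteq> {}"
  proof -
    have "LRm p q \<in> cls (LRm p q)"
      unfolding cls_eq by (auto intro: exI[of _ 1])
    moreover have "(cls (LRm a m), cls (LRm qone b)) \<in> triple_orbit a m b"
      unfolding triple_orbit_def using qmult_one(2)[of m] proportional_refl by fastforce
    ultimately show ?thesis
      unfolding S_def using triality_LRm[OF nz(1,2)] by blast
  qed
  ultimately have "S = {?y}"
    by blast
  then show ?thesis
    unfolding Y_act_def S_def by simp
qed

lemma Y_act_one:
  assumes "y \<in> Y_objects"
  shows "Y_act \<one>\<^bsub>PGOp\<^esub> y = y"
proof -
  obtain a m b \<delta> \<epsilon> l n where y: "y = (triple_orbit a m b, (\<delta>, \<epsilon>), (l, n))"
    and nz: "a \<noteq> 0" "m \<noteq> 0" "b \<noteq> 0" and in_C2: "l \<in> C2" "n \<in> C2" and "\<delta> \<in> SPds" "\<epsilon> \<in> SPds"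
    using assms unfolding Y_objects_eq by blast
  moreover have "twist k (LRm qone qone) = LRm qone qone" if "k \<in> C2" for k
    using twist_conj[OF that, of qone] by simp
  ultimately show ?thesis
    using Y_act_triple_orbit[of qone qone a m b l qone qone n qone qone \<delta> \<epsilon>] by (simp add: one_PGOp)
qed

lemma Y_act_mult:
  assumes "g \<in> carrier PGOp" "h \<in> carrier PGOp" "y \<in> Y_objects"
  shows "Y_act (g \<otimes>\<^bsub>PGOp\<^esub> h) y = Y_act g (Y_act h y)"
proof -
  obtain a m b \<delta> \<epsilon> l n where y: "y = (triple_orbit a m b, (\<delta>, \<epsilon>), (l, n))"
    and nz: "a \<noteq> 0" "m \<noteq> 0" "b \<noteq> 0" and l: "l \<in> C2" and n: "n \<in> C2" and \<delta>: "\<delta> \<in> SPds" and \<epsilon>: "\<epsilon> \<in> SPds"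
    using assms(3) unfolding Y_objects_eq by blast
  obtain p q where pq: "p \<noteq> 0" "q \<noteq> 0" and g: "g = cls (LRm p q)"
    using assms(1) by (rule PGOp_cases)
  obtain p' q' where pq': "p' \<noteq> 0" "q' \<noteq> 0" and h: "h = cls (LRm p' q')"
    using assms(2) by (rule PGOp_cases)
  obtain p1 q1 where PQ1: "p1 \<noteq> 0" "q1 \<noteq> 0" "twist l (LRm p q) = LRm p1 q1"
    using twist_LRm_cases[OF l pq] by blast
  obtain p2 q2 where PQ2: "p2 \<noteq> 0" "q2 \<noteq> 0" "twist n (LRm p q) = LRm p2 q2"
    using twist_LRm_cases[OF n pq] by blast
  obtain p1' q1' where PQ1': "p1' \<noteq> 0" "q1' \<noteq> 0" "twist l (LRm p' q') = LRm p1' q1'"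
    using twist_LRm_cases[OF l pq'] by blast
  obtain p2' q2' where PQ2': "p2' \<noteq> 0" "q2' \<noteq> 0" "twist n (LRm p' q') = LRm p2' q2'"
    using twist_LRm_cases[OF n pq'] by blast
  have tw: "twist l (LRm (p \<odot> p') (q' \<odot> q)) = LRm (p1 \<odot> p1') (q1' \<odot> q1)"
      "twist n (LRm (p \<odot> p') (q' \<odot> q)) = LRm (p2 \<odot> p2') (q2' \<odot> q2)"
    using PQ1 PQ1' PQ2 PQ2' l n by (simp_all add: twist_comp flip: LRm_comp)
  have gh: "g \<otimes>\<^bsub>PGOp\<^esub> h = cls (LRm (p \<odot> p') (q' \<odot> q))"
    unfolding g h using pq pq' by (simp add: mult_PGOp)
  have "Y_act (g \<otimes>\<^bsub>PGOp\<^esub> h) y = (triple_orbit (p \<odot> p' \<odot> a \<odot> qinv (p1 \<odot> p1'))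
      (qinv (q1' \<odot> q1) \<odot> m \<odot> qinv (p2 \<odot> p2')) (qinv (q2' \<odot> q2) \<odot> b \<odot> (q' \<odot> q)),
      (conj_by (LRm (p1 \<odot> p1') (q1' \<odot> q1)) \<delta>, conj_by (LRm (p2 \<odot> p2') (q2' \<odot> q2)) \<epsilon>), (l, n))"
    unfolding gh y
    by (rule Y_act_triple_orbit) (use pq pq' nz PQ1 PQ1' PQ2 PQ2' l n \<delta> \<epsilon> tw in simp_all)
  moreover have "Y_act h y = (triple_orbit (p' \<odot> a \<odot> qinv p1') (qinv q1' \<odot> m \<odot> qinv p2')
      (qinv q2' \<odot> b \<odot> q'), (conj_by (LRm p1' q1') \<delta>, conj_by (LRm p2' q2') \<epsilon>), (l, n))"
    unfolding h y using pq' nz l PQ1' n PQ2' \<delta> \<epsilon> by (rule Y_act_triple_orbit)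
  moreover have "Y_act g (triple_orbit (p' \<odot> a \<odot> qinv p1') (qinv q1' \<odot> m \<odot> qinv p2')
      (qinv q2' \<odot> b \<odot> q'), (conj_by (LRm p1' q1') \<delta>, conj_by (LRm p2' q2') \<epsilon>), (l, n))
    = (triple_orbit (p \<odot> (p' \<odot> a \<odot> qinv p1') \<odot> qinv p1) (qinv q1 \<odot> (qinv q1' \<odot> m \<odot> qinv p2') \<odot> qinv p2)
        (qinv q2 \<odot> (qinv q2' \<odot> b \<odot> q') \<odot> q),
      (conj_by (LRm p1 q1) (conj_by (LRm p1' q1') \<delta>), conj_by (LRm p2 q2) (conj_by (LRm p2' q2') \<epsilon>)), (l, n))"
    unfolding g
    by (rule Y_act_triple_orbit) (use pq pq' nz PQ1 PQ1' PQ2 PQ2' l n \<delta> \<epsilon> conj_by_SPds in simp_all)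
  ultimately show ?thesis
    using PQ1 PQ1' PQ2 PQ2' by (simp add: qinv_mult qmult_assoc conj_by_LRm_comp)
qed

section \<open>The equivalence\<close>

lemma on_class_eqI:
  assumes "A \<noteq> {}" "\<And>x. x \<in> A \<Longrightarrow> f x = c"
  shows "on_class f A = c"
proof -
  have "f ` A = {c}"
    using assms by auto
  then show ?thesis
    by (simp add: on_class_def)
qed

lemma hcls_nonempty: "hcls a \<noteq> {}"
  by (auto simp: hcls_eq intro: exI[of _ 1])

lemma hcls_memD:
  assumes "x \<in> hcls a" "a \<noteq> 0"
  shows "x \<noteq> 0" "x \<sim> a"
  using assms by (auto simp: hcls_eq)

lemma Lcls_hcls: "a \<noteq> 0 \<Longrightarrow> Lcls (hcls a) = cls (LRm a qone)"
  unfolding Lcls_def using hcls_memD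
  by (intro on_class_eqI hcls_nonempty) (simp add: Lm_eq_LRm cls_LRm_eq_iff)

lemma Rcls_hcls: "a \<noteq> 0 \<Longrightarrow> Rcls (hcls a) = cls (LRm qone a)"
  unfolding Rcls_def using hcls_memD
  by (intro on_class_eqI hcls_nonempty) (simp add: Rm_eq_LRm cls_LRm_eq_iff)

lemma cmap_hcls: "s \<noteq> 0 \<Longrightarrow> cmap (hcls s) = cls (LRm s (qinv s))"
  unfolding cmap_def
  by (intro on_class_eqI hcls_nonempty)
    (simp add: Lm_eq_LRm Rm_eq_LRm inv_GOp_LRm LRm_comp cls_LRm_eq_iff hcls_memD proportional_qinv)

lemma SPds_act_cls:
  assumes "p \<noteq> 0" "q \<noteq> 0" "\<delta> \<in> SPds"
  shows "SPds_act (cls (LRm p q)) \<delta> = conj_by (LRm p q) \<delta>"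
  unfolding SPds_act_def
proof (rule on_class_eqI)
  show "cls (LRm p q) \<noteq> {}"
    by (auto simp: cls_eq intro: exI[of _ 1])
  fix \<phi> assume "\<phi> \<in> cls (LRm p q)"
  then obtain r where r: "r \<noteq> 0" "\<phi> = LRm (r *\<^sub>R p) q"
    unfolding cls_eq LRm_scaleR by blast
  then show "conj_by \<phi> \<delta> = conj_by (LRm p q) \<delta>"
    unfolding r(2) using assms by (intro conj_by_cong) (simp_all add: cls_LRm_eq_iff SPds_linear)
qed

lemma cmap_hom: "cmap \<in> hom PHstar PGOp"
  by (rule homI)
    (auto elim!: PHstar_cases simp: cmap_hcls mult_PHstar mult_PGOp qinv_mult)

lemma cmap_inj: "inj_on cmap (carrier PHstar)"
  by (rule inj_onI) (elim PHstar_cases, simp add: cmap_hcls cls_LRm_eq_iff hcls_eq_iff)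

definition Z_objects :: "zobj set" where
  "Z_objects = (carrier PHstar \<times> carrier PHstar) \<times> (SPds \<times> SPds)"

lemma Z_objects_cases:
  assumes "x \<in> Z_objects"
  obtains a b \<delta> \<epsilon> where "a \<noteq> 0" "b \<noteq> 0" "\<delta> \<in> SPds" "\<epsilon> \<in> SPds" "x = ((hcls a, hcls b), (\<delta>, \<epsilon>))"
  using assms unfolding Z_objects_def by (auto elim!: PHstar_cases)

lemma hcls_pair_in_Z_objects:
  "a \<noteq> 0 \<Longrightarrow> b \<noteq> 0 \<Longrightarrow> \<delta> \<in> SPds \<Longrightarrow> \<epsilon> \<in> SPds \<Longrightarrow> ((hcls a, hcls b), (\<delta>, \<epsilon>)) \<in> Z_objects"
  by (simp add: Z_objects_def)

lemma Z_act_hcls: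
  assumes "s \<noteq> 0" "a \<noteq> 0" "b \<noteq> 0" "\<delta> \<in> SPds" "\<epsilon> \<in> SPds"
  shows "Z_act (hcls s) ((hcls a, hcls b), (\<delta>, \<epsilon>))
    = ((hcls (s \<odot> a \<odot> qinv s), hcls (s \<odot> b \<odot> qinv s)),
       (conj_by (LRm s (qinv s)) \<delta>, conj_by (LRm s (qinv s)) \<epsilon>))"
  using assms by (simp add: Z_act_def cmap_hcls SPds_act_cls inv_PHstar mult_PHstar)

lemma Z_act_one:
  assumes "x \<in> Z_objects"
  shows "Z_act \<one>\<^bsub>PHstar\<^esub> x = x"
  using assms by (auto elim!: Z_objects_cases simp: one_PHstar Z_act_hcls)

lemma Z_act_in: "s \<in> carrier PHstar \<Longrightarrow> x \<in> Z_objects \<Longrightarrow> Z_act s x \<in> Z_objects"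
  by (auto elim!: Z_objects_cases PHstar_cases
      simp: Z_act_hcls conj_by_SPds hcls_pair_in_Z_objects)

lemma Z_act_mult:
  assumes "s \<in> carrier PHstar" "t \<in> carrier PHstar" "x \<in> Z_objects"
  shows "Z_act (s \<otimes>\<^bsub>PHstar\<^esub> t) x = Z_act s (Z_act t x)"
  using assms
  by (elim Z_objects_cases PHstar_cases)
    (simp add: Z_act_hcls mult_PHstar conj_by_SPds conj_by_LRm_comp qinv_mult qmult_assoc)

lemma Z_groupoid_eq: "Z_groupoid = action_groupoid PHstar Z_objects Z_act"
  by (simp add: Z_groupoid_def Z_objects_def)

definition sign_conj :: "int \<Rightarrow> quat \<Rightarrow> quat" where
  "sign_conj i = (if i = 1 then id else qcnj)"

lemma sign_conj_in_C2 [simp]: "sign_conj i \<in> C2"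
  by (simp add: sign_conj_def C2_def)

text \<open>
  Proper similitudes and the elements of \<open>SPds\<close> have positive determinant, so the sign only sees whether
  \<open>l\<close> is the identity or the standard involution, which is minus the identity on a space of dimension three.
\<close>

lemma sgn_det_eq_iff:
  assumes \<zeta>: "\<zeta> \<in> carrier GOp" and \<delta>: "\<delta> \<in> SPds" and l: "l \<in> C2" and i: "i \<in> {-1, 1}"
  shows "sgn (det (matrix (\<zeta> \<circ> \<delta> \<circ> l))) = real_of_int i \<longleftrightarrow> l = sign_conj i"
proof -
  obtain a b where ab: "a \<noteq> 0" "b \<noteq> 0" "\<zeta> = LRm a b"
    using \<zeta> by (rule GOp_cases)
  have lin: "linear l"
    using l linear_qcnj by (auto simp: C2_def linear_id)
  have "det (matrix \<zeta>) > 0"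
    using ab by (simp add: det_matrix_LRm)
  moreover have "det (matrix (\<zeta> \<circ> \<delta> \<circ> l)) = det (matrix \<zeta>) * det (matrix l)"
    using ab(3) \<delta> lin by (simp add: det_matrix_comp linear_compose linear_LRm SPds_def)
  moreover have "det (matrix l) = (if l = id then 1 else -1)"
    using l by (auto simp: C2_def det_matrix_qcnj matrix_id_mat_1)
  ultimately have "sgn (det (matrix (\<zeta> \<circ> \<delta> \<circ> l))) = (if l = id then 1 else -1)"
    by (simp add: sgn_mult)
  then show ?thesis
    using l i by (auto simp: C2_def sign_conj_def)
qed

definition Y_part :: "int \<Rightarrow> int \<Rightarrow> yobj set" where
  "Y_part i j = {(triple_orbit a m b, (\<delta>, \<epsilon>), (sign_conj i, sign_conj j)) | a m b \<delta> \<epsilon>.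
    a \<noteq> 0 \<and> m \<noteq> 0 \<and> b \<noteq> 0 \<and> \<delta> \<in> SPds \<and> \<epsilon> \<in> SPds}"

lemma Y_partI:
  "a \<noteq> 0 \<Longrightarrow> m \<noteq> 0 \<Longrightarrow> b \<noteq> 0 \<Longrightarrow> \<delta> \<in> SPds \<Longrightarrow> \<epsilon> \<in> SPds
    \<Longrightarrow> (triple_orbit a m b, (\<delta>, \<epsilon>), (sign_conj i, sign_conj j)) \<in> Y_part i j"
  unfolding Y_part_def by blast

lemma Y_part_cases:
  assumes "y \<in> Y_part i j"
  obtains a m b \<delta> \<epsilon> where "a \<noteq> 0" "m \<noteq> 0" "b \<noteq> 0" "\<delta> \<in> SPds" "\<epsilon> \<in> SPds"
    "y = (triple_orbit a m b, (\<delta>, \<epsilon>), (sign_conj i, sign_conj j))"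
  using assms unfolding Y_part_def by blast

lemma Y_part_subset: "Y_part i j \<subseteq> Y_objects"
  unfolding Y_objects_eq by (fastforce elim!: Y_part_cases)

lemma Y_sub_eq:
  assumes i: "i \<in> {-1, 1}" and j: "j \<in> {-1, 1}"
  shows "Y_sub i j = action_groupoid PGOp (Y_part i j) Y_act"
proof -
  define S :: "yobj set" where "S = {(orb (cls \<zeta>) (cls \<eta>), (\<delta>, \<epsilon>), (l, m)) | \<zeta> \<eta> \<delta> \<epsilon> l m.
        \<zeta> \<in> carrier GOp \<and> \<eta> \<in> carrier GOp \<and>
        sgn (det (matrix (\<zeta> \<circ> \<delta> \<circ> l))) = real_of_int i \<and>
        sgn (det (matrix (\<eta> \<circ> \<epsilon> \<circ> m))) = real_of_int j}"
  have "Y_objects \<inter> S = Y_part i j"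
  proof (intro equalityI subsetI)
    fix y assume y: "y \<in> Y_objects \<inter> S"
    then obtain \<zeta> \<eta> \<delta> \<epsilon> l n where "y = (orb (cls \<zeta>) (cls \<eta>), (\<delta>, \<epsilon>), (l, n))"
      and "\<zeta> \<in> carrier GOp" "\<eta> \<in> carrier GOp"
      and "sgn (det (matrix (\<zeta> \<circ> \<delta> \<circ> l))) = real_of_int i"
      and "sgn (det (matrix (\<eta> \<circ> \<epsilon> \<circ> n))) = real_of_int j"
      unfolding S_def by blast
    moreover from y obtain a m b \<delta>' \<epsilon>' l' n' where y': "y = (triple_orbit a m b, (\<delta>', \<epsilon>'), (l', n'))"
      "a \<noteq> 0" "m \<noteq> 0" "b \<noteq> 0" "\<delta>' \<in> SPds" "\<epsilon>' \<in> SPds" "l' \<in> C2" "n' \<in> C2"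
      unfolding Y_objects_eq by blast
    ultimately have "l' = sign_conj i" "n' = sign_conj j"
      using i j sgn_det_eq_iff by (metis Pair_inject)+
    with y' show "y \<in> Y_part i j"
      by (simp add: Y_partI)
  next
    fix y assume y: "y \<in> Y_part i j"
    then obtain a m b \<delta> \<epsilon> where nz: "a \<noteq> 0" "m \<noteq> 0" "b \<noteq> 0" and \<delta>: "\<delta> \<in> SPds" and \<epsilon>: "\<epsilon> \<in> SPds"
      and y_eq: "y = (triple_orbit a m b, (\<delta>, \<epsilon>), (sign_conj i, sign_conj j))"
      by (rule Y_part_cases)
    let ?\<zeta> = "LRm a m" and ?\<eta> = "LRm qone b"
    have "y = (orb (cls ?\<zeta>) (cls ?\<eta>), (\<delta>, \<epsilon>), (sign_conj i, sign_conj j))"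
      using nz by (simp add: y_eq orb_LRm)
    moreover have "?\<zeta> \<in> carrier GOp" "?\<eta> \<in> carrier GOp"
      using nz by simp_all
    ultimately have "y \<in> S"
      unfolding S_def using sgn_det_eq_iff[OF _ \<delta> sign_conj_in_C2 i] sgn_det_eq_iff[OF _ \<epsilon> sign_conj_in_C2 j]
      by blast
    then show "y \<in> Y_objects \<inter> S"
      using y Y_part_subset by blast
  qed
  then show ?thesis
    unfolding Y_sub_def Y_groupoid_def full_subcategory_action_groupoid S_def by simp
qed

text \<open>
  The orbit in the value of the functor at \<open>(a, b)\<close>. The entry \<open>1\<close> stands where the acting class
  \<open>x \<mapsto> p x q\<close> multiplies by \<open>p\<close> and \<open>q\<close>, or by their inverses, on opposite sides: the middle entry if the
  signs agree, the first one for the signs \<open>(-1, 1)\<close>, and the last one for \<open>(1, -1)\<close>.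
\<close>

definition H_orbit :: "int \<Rightarrow> int \<Rightarrow> quat \<Rightarrow> quat \<Rightarrow> (pgo \<times> pgo) set" where
  "H_orbit i j a b =
    (if i = j then triple_orbit a qone b
     else if i = -1 then triple_orbit qone a b
     else triple_orbit a b qone)"

lemma H_obj_hcls:
  assumes "i \<in> {-1, 1}" "j \<in> {-1, 1}" "a \<noteq> 0" "b \<noteq> 0"
  shows "H_obj i j ((hcls a, hcls b), (\<delta>, \<epsilon>)) = (H_orbit i j a b, (\<delta>, \<epsilon>), (sign_conj i, sign_conj j))"
  using assms by (auto simp: H_obj_def H_orbit_def sign_conj_def Lcls_hcls Rcls_hcls orb_LRm)

lemma H_orbit_eq_iff:
  assumes "a \<noteq> 0" "b \<noteq> 0" "a' \<noteq> 0" "b' \<noteq> 0"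
  shows "H_orbit i j a b = H_orbit i j a' b' \<longleftrightarrow> a \<sim> a' \<and> b \<sim> b'"
  using assms by (auto simp: H_orbit_def triple_orbit_eq_iff)

lemma H_obj_in:
  assumes "i \<in> {-1, 1}" "j \<in> {-1, 1}" "x \<in> Z_objects"
  shows "H_obj i j x \<in> Y_part i j"
  using assms by (elim Z_objects_cases) (simp add: H_obj_hcls H_orbit_def Y_partI)

lemma H_obj_inj:
  assumes "i \<in> {-1, 1}" "j \<in> {-1, 1}"
  shows "inj_on (H_obj i j) Z_objects"
  using assms
  by (intro inj_onI) (elim Z_objects_cases, simp add: H_obj_hcls H_orbit_eq_iff hcls_eq_iff)

lemma H_obj_equivariant:
  assumes ij: "i \<in> {-1, 1}" "j \<in> {-1, 1}" and s: "s \<in> carrier PHstar" and x: "x \<in> Z_objects"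
  shows "Y_act (cmap s) (H_obj i j x) = H_obj i j (Z_act s x)"
proof -
  obtain t where t: "t \<noteq> 0" "s = hcls t"
    using s by (rule PHstar_cases)
  obtain a b \<delta> \<epsilon> where x_eq: "x = ((hcls a, hcls b), (\<delta>, \<epsilon>))"
    and ab: "a \<noteq> 0" "b \<noteq> 0" and \<delta>\<epsilon>: "\<delta> \<in> SPds" "\<epsilon> \<in> SPds"
    using x by (rule Z_objects_cases)
  have act: "Y_act (cls (LRm t (qinv t))) (triple_orbit u m v, (\<delta>, \<epsilon>), (sign_conj k, sign_conj l)) =
    (triple_orbit (t \<odot> u \<odot> qinv t) (t \<odot> m \<odot> qinv t) (t \<odot> v \<odot> qinv t),
     (conj_by (LRm t (qinv t)) \<delta>, conj_by (LRm t (qinv t)) \<epsilon>), (sign_conj k, sign_conj l))"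
    if "u \<noteq> 0" "m \<noteq> 0" "v \<noteq> 0" for u m v k l
    using Y_act_triple_orbit[of t "qinv t" u m v "sign_conj k" t "qinv t" "sign_conj l" t "qinv t" \<delta> \<epsilon>]
      that t(1) \<delta>\<epsilon> by (simp add: twist_conj)
  show ?thesis
    using ij t(1) ab \<delta>\<epsilon>
    by (simp add: x_eq t(2) cmap_hcls Z_act_hcls H_obj_hcls H_orbit_def act)
qed

lemma qinv_qcnj: "x \<noteq> 0 \<Longrightarrow> qinv (qcnj x) = inverse (qnorm x) *\<^sub>R x"
  by (simp add: qinv_cnj qinv_def qcnj_scaleR)

text \<open>
  The twist of \<open>x \<mapsto> p x q\<close> by the standard involution has the factors \<open>qcnj q\<close> and \<open>qcnj p\<close>. Up to real
  scalars their inverses are \<open>q\<close> and \<open>p\<close>, so the transformed triple is described without conjugates.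
\<close>

lemma Y_act_LRm:
  assumes "p \<noteq> 0" "q \<noteq> 0" "a \<noteq> 0" "m \<noteq> 0" "b \<noteq> 0" "\<delta> \<in> SPds" "\<epsilon> \<in> SPds"
  shows "\<exists>\<delta>' \<epsilon>'. \<delta>' \<in> SPds \<and> \<epsilon>' \<in> SPds \<and>
    Y_act (cls (LRm p q)) (triple_orbit a m b, (\<delta>, \<epsilon>), (sign_conj i, sign_conj j)) =
    (triple_orbit (p \<odot> a \<odot> (if i = 1 then qinv p else q))
      ((if i = 1 then qinv q else p) \<odot> m \<odot> (if j = 1 then qinv p else q))
      ((if j = 1 then qinv q else p) \<odot> b \<odot> q), (\<delta>', \<epsilon>'), (sign_conj i, sign_conj j))"
proof -
  let ?p = "\<lambda>i :: int. if i = 1 then p else qcnj q" and ?q = "\<lambda>i :: int. if i = 1 then q else qcnj p"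
  have tw: "twist (sign_conj i) (LRm p q) = LRm (?p i) (?q i)" for i
    by (simp add: sign_conj_def twist_qcnj_LRm)
  have nz: "?p i \<noteq> 0" "?q i \<noteq> 0" for i
    using assms by simp_all
  have "Y_act (cls (LRm p q)) (triple_orbit a m b, (\<delta>, \<epsilon>), (sign_conj i, sign_conj j)) =
    (triple_orbit (p \<odot> a \<odot> qinv (?p i)) (qinv (?q i) \<odot> m \<odot> qinv (?p j)) (qinv (?q j) \<odot> b \<odot> q),
     (conj_by (LRm (?p i) (?q i)) \<delta>, conj_by (LRm (?p j) (?q j)) \<epsilon>), (sign_conj i, sign_conj j))"
    using assms nz tw by (intro Y_act_triple_orbit) simp_all
  moreover have "triple_orbit (p \<odot> a \<odot> qinv (?p i)) (qinv (?q i) \<odot> m \<odot> qinv (?p j)) (qinv (?q j) \<odot> b \<odot> q)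
    = triple_orbit (p \<odot> a \<odot> (if i = 1 then qinv p else q))
      ((if i = 1 then qinv q else p) \<odot> m \<odot> (if j = 1 then qinv p else q))
      ((if j = 1 then qinv q else p) \<odot> b \<odot> q)"
    using assms by (simp add: triple_orbit_eq_iff qinv_qcnj)
  ultimately show ?thesis
    using conj_by_SPds[OF assms(6) nz] conj_by_SPds[OF assms(7) nz] by metis
qed

text \<open>
  The entry \<open>1\<close> is sent to \<open>p q\<close> or to \<open>q\<inverse> p\<inverse>\<close>, and this has to be \<open>1\<close> again up to a scalar.
\<close>

lemma H_obj_stabilizer:
  assumes ij: "i \<in> {-1, 1}" "j \<in> {-1, 1}" and pq: "p \<noteq> 0" "q \<noteq> 0"
    and x: "x \<in> Z_objects" "x' \<in> Z_objects"
    and eq: "Y_act (cls (LRm p q)) (H_obj i j x) = H_obj i j x'"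
  shows "q \<sim> qinv p"
proof -
  obtain a b \<delta> \<epsilon> where x_eq: "x = ((hcls a, hcls b), (\<delta>, \<epsilon>))"
    and ab: "a \<noteq> 0" "b \<noteq> 0" and \<delta>\<epsilon>: "\<delta> \<in> SPds" "\<epsilon> \<in> SPds"
    using x(1) by (rule Z_objects_cases)
  obtain a' b' \<delta>' \<epsilon>' where x'_eq: "x' = ((hcls a', hcls b'), (\<delta>', \<epsilon>'))"
    and ab': "a' \<noteq> 0" "b' \<noteq> 0"
    using x(2) by (rule Z_objects_cases)
  note act = Y_act_LRm[OF pq _ _ _ \<delta>\<epsilon>, of _ _ _ i j]
  have "p \<odot> q \<sim> qone \<or> qinv q \<odot> qinv p \<sim> qone"
    using ij eq act[of a qone b] act[of qone a b] act[of a b qone] pq ab ab'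
    by (auto simp: x_eq x'_eq H_obj_hcls H_orbit_def triple_orbit_eq_iff)
  then show ?thesis
    using pq proportional_mult_eq_one_iff[of p q] proportional_mult_eq_one_iff[of "qinv q" "qinv p"]
    by (auto intro: proportional_sym)
qed

text \<open>
  The entry that has to become \<open>1\<close> is multiplied by a power of \<open>p\<close> alone when \<open>q = 1\<close>, so a suitable \<open>p\<close>
  removes it: its inverse, or the entry itself if both signs are \<open>1\<close>, where the power is \<open>p\<inverse>\<close>.
\<close>

lemma H_obj_dense:
  assumes ij: "i \<in> {-1, 1}" "j \<in> {-1, 1}" and y: "y \<in> Y_part i j"
  shows "\<exists>k \<in> carrier PGOp. \<exists>x \<in> Z_objects. Y_act k y = H_obj i j x"
proof -
  obtain a m b \<delta> \<epsilon> where nz: "a \<noteq> 0" "m \<noteq> 0" "b \<noteq> 0" and \<delta>\<epsilon>: "\<delta> \<in> SPds" "\<epsilon> \<in> SPds"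
    and y_eq: "y = (triple_orbit a m b, (\<delta>, \<epsilon>), (sign_conj i, sign_conj j))"
    using y by (rule Y_part_cases)
  define p where "p = (if i = j then if i = 1 then m else qinv m else if i = -1 then qinv a else qinv b)"
  have p: "p \<noteq> 0"
    using nz by (simp add: p_def)
  obtain \<delta>' \<epsilon>' where \<delta>\<epsilon>': "\<delta>' \<in> SPds" "\<epsilon>' \<in> SPds" and act: "Y_act (cls (LRm p qone)) y =
    (triple_orbit (p \<odot> a \<odot> (if i = 1 then qinv p else qone))
      ((if i = 1 then qone else p) \<odot> m \<odot> (if j = 1 then qinv p else qone))
      ((if j = 1 then qone else p) \<odot> b), (\<delta>', \<epsilon>'), (sign_conj i, sign_conj j))"
    using Y_act_LRm[OF p qone_neq_0 nz \<delta>\<epsilon>, of i j] by (auto simp: y_eq)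
  have "\<exists>a' b'. a' \<noteq> 0 \<and> b' \<noteq> 0 \<and> triple_orbit (p \<odot> a \<odot> (if i = 1 then qinv p else qone))
      ((if i = 1 then qone else p) \<odot> m \<odot> (if j = 1 then qinv p else qone))
      ((if j = 1 then qone else p) \<odot> b) = H_orbit i j a' b'"
  proof -
    consider "i = 1 \<and> j = 1" | "i = -1 \<and> j = 1" | "i = 1 \<and> j = -1" | "i = -1 \<and> j = -1"
      using ij by auto
    then show ?thesis
    proof cases
      case 1
      then show ?thesis
        using nz by (intro exI[of _ "m \<odot> a \<odot> qinv m"] exI[of _ b]) (simp add: H_orbit_def p_def)
    next
      case 2
      then show ?thesis
        using nz by (intro exI[of _ "p \<odot> m \<odot> qinv p"] exI[of _ b]) (simp add: H_orbit_def p_def)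
    next
      case 3
      then show ?thesis
        using nz by (intro exI[of _ "p \<odot> a \<odot> qinv p"] exI[of _ m]) (simp add: H_orbit_def p_def)
    next
      case 4
      then show ?thesis
        using nz by (intro exI[of _ "p \<odot> a"] exI[of _ "p \<odot> b"]) (simp add: H_orbit_def p_def)
    qed
  qed
  then obtain a' b' where ab': "a' \<noteq> 0" "b' \<noteq> 0" and
    "Y_act (cls (LRm p qone)) y = H_obj i j ((hcls a', hcls b'), (\<delta>', \<epsilon>'))"
    using act ij by (auto simp: H_obj_hcls)
  then show ?thesis
    using p hcls_pair_in_Z_objects[OF ab' \<delta>\<epsilon>'] by (metis cls_in_PGOp qone_neq_0)
qed

theorem theorem13:
  fixes i j :: int
  assumes "i \<in> {-1, 1}" and "j \<in> {-1, 1}"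
  shows "equivalent_categories (Y_sub i j) Z_groupoid \<and>
         is_equivalence Z_groupoid (Y_sub i j) (H_functor i j)"
proof -
  have "is_equivalence (action_groupoid PHstar Z_objects Z_act)
      (action_groupoid PGOp (Y_part i j) Y_act) \<lparr>on_obj = H_obj i j, on_mor = (\<lambda>_ _. cmap)\<rparr>"
  proof (rule is_equivalence_action_groupoids[OF group_PHstar group_PGOp])
    fix k x x'
    assume k: "k \<in> carrier PGOp" and x: "x \<in> Z_objects" "x' \<in> Z_objects"
      and eq: "Y_act k (H_obj i j x) = H_obj i j x'"
    obtain p q where pq: "p \<noteq> 0" "q \<noteq> 0" "k = cls (LRm p q)"
      using k by (rule PGOp_cases)
    have "q \<sim> qinv p"
      using H_obj_stabilizer[OF assms pq(1,2) x] eq pq(3) by simp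
    then have k_eq: "cmap (hcls p) = k"
      using pq by (simp add: cmap_hcls cls_LRm_eq_iff proportional_sym)
    have "H_obj i j (Z_act (hcls p) x) = H_obj i j x'"
      using H_obj_equivariant[OF assms hcls_in_PHstar[OF pq(1)] x(1)] eq k_eq by simp
    then have "Z_act (hcls p) x = x'"
      using H_obj_inj[OF assms] x Z_act_in[OF hcls_in_PHstar[OF pq(1)] x(1)] by (auto dest: inj_onD)
    then show "\<exists>s \<in> carrier PHstar. cmap s = k \<and> Z_act s x = x'"
      using k_eq hcls_in_PHstar[OF pq(1)] by blast
  qed (use assms subsetD[OF Y_part_subset] in \<open>simp_all add: Z_act_one Z_act_mult Y_act_one Y_act_mult
      cmap_hom cmap_inj H_obj_in H_obj_equivariant H_obj_dense\<close>)
  then have "is_equivalence Z_groupoid (Y_sub i j) (H_functor i j)"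
    by (simp add: Z_groupoid_eq Y_sub_eq[OF assms] H_functor_def)
  then show ?thesis
    using is_equivalence_imp_equivalent_categories_sym by blast
qed

end
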